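(* Let $\Omega$ be a bounded spatial domain with sufficiently regular boundary, $T>0$, $0<\alpha<1$, and let $\lambda_1>0$ be the minimal eigenvalue of $-\Delta\omega=\lambda\omega$ in $\Omega$, $\omega=0$ on $\partial\Omega$. Let $\kappa<\lambda_1$. Let $u$ be the solution of $$\partial_t u-\Delta u=\kappa u+f\ \text{ in }\Omega\times(0,T],\qquad u=0\ \text{ on }\partial\Omega\times[0,T],\qquad u(\cdot,0)=u_0,$$ and suppose that $\|\partial_t^k u(t)\|\le M t^{\alpha-k}$ for $k=1,2,3$ and $0<t\le T$, with some constant $M$. Let $N\ge2$ be an integer, $\tau=T/N$, $t_n=n\tau$, and let $U^n$ be given by the BDF2 semi-discrete scheme $$U^1-U^0=\tau\Delta U^1+\kappa\tau U^1+\tau f(t_1)\ \text{ in }\Omega,$$ $$\tfrac32U^n-2U^{n-1}+\tfrac12U^{n-2}=\tau\Delta U^n+\kappa\tau U^n+\tau f(t_n)\ \text{ in }\Omega,\quad 2\le n\le N,$$ with $U^0=u_0$ and $U^n=0$ on $\partial\Omega$ for $1\le n\le N$. Let $e^n=u(\cdot,t_n)-U^n$. Then there is a constant $C_{u,\alpha}>0$ depending only on $\alpha$ and $M$ such that, whenever $\tau<1/(4(\lambda_1-\kappa))$, for all $1\le n\le N$, $$\|e^n\|\le e^{-(\lambda_1-\kappa)t_n/2}\|e^{0}\|+2C_{u,\alpha}\Big(C_{11}e^{-(\lambda_1-\kappa)t_n/2}\tau^\alpha+C_{12}\,t_n^{\alpha-2}\tau^2\Big),$$ where $C_{11}:=\frac{2}{2-\alpha}+4e^{-(\lambda_1-\kappa)t_n/4}$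 and $$C_{12}:=\begin{cases}\frac{1}{2-\alpha}\big(2^{2-\alpha}(1-e^{-(\lambda_1-\kappa)t_n/2})-1\big), & t_n>-\frac{2}{\lambda_1-\kappa}\ln(1-2^{\alpha-2}),\\ 0,& t_n\le -\frac{2}{\lambda_1-\kappa}\ln(1-2^{\alpha-2}).\end{cases}$$
   Context: $\|\cdot\|$ denotes the $L^2(\Omega)$ norm. The Dirichlet eigenvalue problem has a nondecreasing sequence of positive eigenvalues $\lambda_1\le\lambda_2\le\cdots\to\infty$ whose eigenfunctions form an orthonormal basis of $L^2(\Omega)$. The solution $u$ is continuous from $[0,T]$ into $L^2(\Omega)$ and, on $(0,T]$, three times continuously differentiable in time with values in $L^2(\Omega)$, with $u(t)$ in the domain of the Dirichlet Laplacian; $f$ is the corresponding given source term, and $U^n$ for $n\ge1$ lies in the domain of the Dirichlet Laplacian. The constant $C_{u,\alpha}$ is independent of $n$, $N$, $\tau$, $T$, $\kappa$ and $\Omega$. *)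

theory Defs
  imports "HOL-Analysis.Analysis"
begin

text \<open>
  The constant of the theorem may depend on two real numbers only, in particular neither on the
  domain nor on the space dimension.  Hence the dimension \<open>d\<close> must be quantified inside a
  formula, which the type class \<open>euclidean_space\<close> does not allow.  We therefore represent
  \<open>d\<close>-dimensional real space by the extensional functions on \<open>{..<d}\<close>, with the product
  topology and the (completed) product Lebesgue measure.  Functions on it are total HOL functions
  whose values off the domain are irrelevant, and elements of the space of square integrable
  functions are represented by functions, not by classes: equality in it is equality almost
  everywhere.
\<close>

definition L2 :: "'x measure \<Rightarrow> ('x \<Rightarrow> real) set" where
  "L2 Q = {v \<in> borel_measurable Q. integrable Q (\<lambda>x. (v x)\<^sup>2)}"

definition L2_inner :: "'x measure \<Rightarrow> ('x \<Rightarrow> real) \<Rightarrow> ('x \<Rightarrow> real) \<Rightarrow> real" where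
  "L2_inner Q v w = (LINT x|Q. v x * w x)"

definition L2_norm :: "'x measure \<Rightarrow> ('x \<Rightarrow> real) \<Rightarrow> real" where
  "L2_norm Q v = sqrt (LINT x|Q. (v x)\<^sup>2)"

definition L2_continuous_on :: "'x measure \<Rightarrow> real set \<Rightarrow> (real \<Rightarrow> 'x \<Rightarrow> real) \<Rightarrow> bool" where
  "L2_continuous_on Q S v \<longleftrightarrow>
     (\<forall>t\<in>S. v t \<in> L2 Q) \<and>
     (\<forall>t\<in>S. ((\<lambda>s. L2_norm Q (\<lambda>x. v s x - v t x)) \<longlongrightarrow> 0) (at t within S))"

definition L2_has_derivative_on ::
  "'x measure \<Rightarrow> real set \<Rightarrow> (real \<Rightarrow> 'x \<Rightarrow> real) \<Rightarrow> (real \<Rightarrow> 'x \<Rightarrow> real) \<Rightarrow> bool" where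
  "L2_has_derivative_on Q S v v' \<longleftrightarrow>
     (\<forall>t\<in>S. ((\<lambda>s. L2_norm Q (\<lambda>x. (v s x - v t x) / (s - t) - v' t x)) \<longlongrightarrow> 0) (at t within S))"

text \<open>\<open>D k\<close> is the \<open>k\<close>-th derivative of \<open>v\<close>; at an endpoint of \<open>S\<close> it is one-sided.\<close>

definition L2_derivatives_on ::
  "'x measure \<Rightarrow> real set \<Rightarrow> nat \<Rightarrow> (real \<Rightarrow> 'x \<Rightarrow> real) \<Rightarrow> (nat \<Rightarrow> real \<Rightarrow> 'x \<Rightarrow> real) \<Rightarrow> bool" where
  "L2_derivatives_on Q S m v D \<longleftrightarrow>
     D 0 = v \<and>
     (\<forall>k\<le>m. L2_continuous_on Q S (D k)) \<and>
     (\<forall>k<m. L2_has_derivative_on Q S (D k) (D (Suc k)))"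

definition Rn_top :: "nat \<Rightarrow> (nat \<Rightarrow> real) topology" where
  "Rn_top d = product_topology (\<lambda>_. euclideanreal) {..<d}"

definition leb_on :: "nat \<Rightarrow> (nat \<Rightarrow> real) set \<Rightarrow> (nat \<Rightarrow> real) measure" where
  "leb_on d \<Omega> = restrict_space (completion (\<Pi>\<^sub>M i\<in>{..<d}. (lborel :: real measure))) \<Omega>"

definition bounded_domain :: "nat \<Rightarrow> (nat \<Rightarrow> real) set \<Rightarrow> bool" where
  "bounded_domain d \<Omega> \<longleftrightarrow>
     openin (Rn_top d) \<Omega> \<and> connectedin (Rn_top d) \<Omega> \<and> \<Omega> \<noteq> {} \<and>
     (\<exists>B. \<forall>x\<in>\<Omega>. \<forall>i<d. \<bar>x i\<bar> \<le> B)"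

definition partial_deriv :: "nat \<Rightarrow> ((nat \<Rightarrow> real) \<Rightarrow> real) \<Rightarrow> (nat \<Rightarrow> real) \<Rightarrow> real" where
  "partial_deriv i \<phi> x = deriv (\<lambda>s. \<phi> (x(i := s))) (x i)"

primrec C_k :: "nat \<Rightarrow> nat \<Rightarrow> ((nat \<Rightarrow> real) \<Rightarrow> real) \<Rightarrow> bool" where
  "C_k d 0 \<phi> \<longleftrightarrow> continuous_map (Rn_top d) euclideanreal \<phi>"
| "C_k d (Suc k) \<phi> \<longleftrightarrow>
     continuous_map (Rn_top d) euclideanreal \<phi> \<and>
     (\<forall>i<d. (\<forall>x\<in>topspace (Rn_top d). (\<lambda>s. \<phi> (x(i := s))) differentiable (at (x i))) \<and>
            C_k d k (partial_deriv i \<phi>))"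

definition test_function :: "nat \<Rightarrow> (nat \<Rightarrow> real) set \<Rightarrow> ((nat \<Rightarrow> real) \<Rightarrow> real) \<Rightarrow> bool" where
  "test_function d \<Omega> \<phi> \<longleftrightarrow>
     (\<forall>k. C_k d k \<phi>) \<and>
     (\<exists>K. compactin (Rn_top d) K \<and> K \<subseteq> \<Omega> \<and> (\<forall>x\<in>topspace (Rn_top d) - K. \<phi> x = 0))"

text \<open>
  The Sobolev space of functions vanishing on the boundary is the closure of the test functions
  in the first order Sobolev norm; \<open>G i\<close> is the \<open>i\<close>-th weak partial derivative of \<open>v\<close>.
\<close>

definition H10_gradient ::
  "nat \<Rightarrow> (nat \<Rightarrow> real) set \<Rightarrow> ((nat \<Rightarrow> real) \<Rightarrow> real) \<Rightarrow> (nat \<Rightarrow> (nat \<Rightarrow> real) \<Rightarrow> real) \<Rightarrow> bool" where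
  "H10_gradient d \<Omega> v G \<longleftrightarrow>
     v \<in> L2 (leb_on d \<Omega>) \<and> (\<forall>i<d. G i \<in> L2 (leb_on d \<Omega>)) \<and>
     (\<exists>\<phi>. (\<forall>k. test_function d \<Omega> (\<phi> k)) \<and>
       (\<lambda>k. L2_norm (leb_on d \<Omega>) (\<lambda>x. \<phi> k x - v x)) \<longlonglongrightarrow> 0 \<and>
       (\<forall>i<d. (\<lambda>k. L2_norm (leb_on d \<Omega>) (\<lambda>x. partial_deriv i (\<phi> k) x - G i x)) \<longlonglongrightarrow> 0))"

text \<open>
  \<open>dirichlet_laplacian d \<Omega> v w\<close>: \<open>v\<close> lies in the domain of the Dirichlet Laplacian (in
  particular it vanishes on the boundary) and its Laplacian is \<open>w\<close>.  The domain consists of the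
  functions of the above Sobolev space whose distributional Laplacian is square integrable; no
  regularity of the boundary is needed for this, and for a regular boundary these are
  the second order Sobolev functions with zero trace.
\<close>

definition dirichlet_laplacian ::
  "nat \<Rightarrow> (nat \<Rightarrow> real) set \<Rightarrow> ((nat \<Rightarrow> real) \<Rightarrow> real) \<Rightarrow> ((nat \<Rightarrow> real) \<Rightarrow> real) \<Rightarrow> bool" where
  "dirichlet_laplacian d \<Omega> v w \<longleftrightarrow>
     w \<in> L2 (leb_on d \<Omega>) \<and>
     (\<exists>G. H10_gradient d \<Omega> v G \<and>
       (\<forall>\<phi>. test_function d \<Omega> \<phi> \<longrightarrow>
         (\<Sum>i<d. L2_inner (leb_on d \<Omega>) (G i) (partial_deriv i \<phi>)) = - L2_inner (leb_on d \<Omega>) w \<phi>))"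

definition dirichlet_eigenfunction ::
  "nat \<Rightarrow> (nat \<Rightarrow> real) set \<Rightarrow> real \<Rightarrow> ((nat \<Rightarrow> real) \<Rightarrow> real) \<Rightarrow> bool" where
  "dirichlet_eigenfunction d \<Omega> \<mu> \<omega> \<longleftrightarrow>
     L2_norm (leb_on d \<Omega>) \<omega> \<noteq> 0 \<and>
     (\<exists>w. dirichlet_laplacian d \<Omega> \<omega> w \<and> (AE x in leb_on d \<Omega>. - w x = \<mu> * \<omega> x))"

definition minimal_dirichlet_eigenvalue :: "nat \<Rightarrow> (nat \<Rightarrow> real) set \<Rightarrow> real \<Rightarrow> bool" where
  "minimal_dirichlet_eigenvalue d \<Omega> \<mu> \<longleftrightarrow>
     (\<exists>\<omega>. dirichlet_eigenfunction d \<Omega> \<mu> \<omega>) \<and>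
     (\<forall>\<nu> \<omega>. dirichlet_eigenfunction d \<Omega> \<nu> \<omega> \<longrightarrow> \<mu> \<le> \<nu>)"

text \<open>The eigenvalues are numbered from \<open>0\<close>, so \<open>lam 0\<close> is the minimal one.\<close>

definition dirichlet_eigenbasis ::
  "nat \<Rightarrow> (nat \<Rightarrow> real) set \<Rightarrow> (nat \<Rightarrow> real) \<Rightarrow> (nat \<Rightarrow> (nat \<Rightarrow> real) \<Rightarrow> real) \<Rightarrow> bool" where
  "dirichlet_eigenbasis d \<Omega> lam \<omega> \<longleftrightarrow>
     (\<forall>k. 0 < lam k) \<and> incseq lam \<and> filterlim lam at_top sequentially \<and>
     (\<forall>k. dirichlet_eigenfunction d \<Omega> (lam k) (\<omega> k)) \<and>
     (\<forall>j k. L2_inner (leb_on d \<Omega>) (\<omega> j) (\<omega> k) = (if j = k then 1 else 0)) \<and>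
     (\<forall>v\<in>L2 (leb_on d \<Omega>).
       (\<lambda>n. L2_norm (leb_on d \<Omega>)
              (\<lambda>x. v x - (\<Sum>k<n. L2_inner (leb_on d \<Omega>) v (\<omega> k) * \<omega> k x))) \<longlonglongrightarrow> 0)"

text \<open>
  \<open>D k\<close> is the \<open>k\<close>-th time derivative of the solution \<open>u\<close>.  The boundary condition for positive
  times is part of \<open>dirichlet_laplacian\<close>.
\<close>

definition parabolic_solution ::
  "nat \<Rightarrow> (nat \<Rightarrow> real) set \<Rightarrow> real \<Rightarrow> real \<Rightarrow> (real \<Rightarrow> (nat \<Rightarrow> real) \<Rightarrow> real) \<Rightarrow>
   ((nat \<Rightarrow> real) \<Rightarrow> real) \<Rightarrow> (real \<Rightarrow> (nat \<Rightarrow> real) \<Rightarrow> real) \<Rightarrow>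
   (nat \<Rightarrow> real \<Rightarrow> (nat \<Rightarrow> real) \<Rightarrow> real) \<Rightarrow> bool" where
  "parabolic_solution d \<Omega> T \<kappa> f u0 u D \<longleftrightarrow>
     L2_continuous_on (leb_on d \<Omega>) {0..T} u \<and>
     L2_derivatives_on (leb_on d \<Omega>) {0<..T} 3 u D \<and>
     (\<forall>t\<in>{0<..T}. \<exists>w. dirichlet_laplacian d \<Omega> (u t) w \<and>
        (AE x in leb_on d \<Omega>. D 1 t x - w x = \<kappa> * u t x + f t x)) \<and>
     (AE x in leb_on d \<Omega>. u 0 x = u0 x)"

definition bdf2_scheme ::
  "nat \<Rightarrow> (nat \<Rightarrow> real) set \<Rightarrow> real \<Rightarrow> (real \<Rightarrow> (nat \<Rightarrow> real) \<Rightarrow> real) \<Rightarrow>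
   ((nat \<Rightarrow> real) \<Rightarrow> real) \<Rightarrow> real \<Rightarrow> nat \<Rightarrow> (nat \<Rightarrow> (nat \<Rightarrow> real) \<Rightarrow> real) \<Rightarrow> bool" where
  "bdf2_scheme d \<Omega> \<kappa> f u0 \<tau> N U \<longleftrightarrow>
     (AE x in leb_on d \<Omega>. U 0 x = u0 x) \<and>
     (\<exists>w. dirichlet_laplacian d \<Omega> (U 1) w \<and>
        (AE x in leb_on d \<Omega>. U 1 x - U 0 x = \<tau> * w x + \<kappa> * \<tau> * U 1 x + \<tau> * f \<tau> x)) \<and>
     (\<forall>n. 2 \<le> n \<and> n \<le> N \<longrightarrow>
       (\<exists>w. dirichlet_laplacian d \<Omega> (U n) w \<and>
         (AE x in leb_on d \<Omega>.
            3/2 * U n x - 2 * U (n - 1) x + 1/2 * U (n - 2) x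
              = \<tau> * w x + \<kappa> * \<tau> * U n x + \<tau> * f (real n * \<tau>) x)))"

definition C11 :: "real \<Rightarrow> real \<Rightarrow> real \<Rightarrow> real \<Rightarrow> real" where
  "C11 \<alpha> lam1 \<kappa> t = 2 / (2 - \<alpha>) + 4 * exp (- (lam1 - \<kappa>) * t / 4)"

definition C12 :: "real \<Rightarrow> real \<Rightarrow> real \<Rightarrow> real \<Rightarrow> real" where
  "C12 \<alpha> lam1 \<kappa> t =
     (if t > - (2 / (lam1 - \<kappa>)) * ln (1 - 2 powr (\<alpha> - 2))
      then 1 / (2 - \<alpha>) * (2 powr (2 - \<alpha>) * (1 - exp (- (lam1 - \<kappa>) * t / 2)) - 1)
      else 0)"

end

theory Submission
  imports Defs
begin

text \<open>
  Since \<open>U 0\<close> and \<open>u 0\<close> agree almost everywhere, the initial error vanishes and only the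
  truncation errors \<open>\<rho> j\<close> are propagated.  In the eigenbasis the error satisfies
  \<open>(3/2 + z) * x n = 2 * x (n - 1) - 1/2 * x (n - 2) + r n\<close> with
  \<open>z \<ge> z0 = \<tau> * (lam1 - \<kappa>)\<close>, whose characteristic roots \<open>1 / (2 - s)\<close> and \<open>1 / (2 + s)\<close>,
  \<open>s = csqrt (1 - 2 * z)\<close>, are bounded in modulus by \<open>exp (- 3/4 * z0)\<close> and \<open>1/2\<close>.  Hence the error at
  step \<open>n\<close> is at most a constant times the sum over \<open>j\<close> of
  \<open>exp (- 3/4 * z0 * (n - j)) * \<parallel>\<rho> j\<parallel>\<close>.  By duality and Taylor expansion \<open>\<parallel>\<rho> j\<parallel>\<close> is of order
  \<open>\<tau> powr \<alpha> * j powr (\<alpha> - 3)\<close>.  For \<open>j \<le> n / 3\<close> the exponential is at most \<open>exp (- z0 * n / 2)\<close>, and for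
  \<open>j > n / 3\<close> one uses \<open>j powr (\<alpha> - 3) \<le> 27 * n powr (\<alpha> - 3)\<close>.
\<close>

section \<open>Square integrable functions\<close>

lemma L2_mult_integrable:
  assumes "v \<in> L2 Q" "w \<in> L2 Q"
  shows "integrable Q (\<lambda>x. v x * w x)"
proof (rule Bochner_Integration.integrable_bound)
  show "integrable Q (\<lambda>x. (v x)\<^sup>2 + (w x)\<^sup>2)"
    using assms by (auto simp: L2_def)
  show "(\<lambda>x. v x * w x) \<in> borel_measurable Q"
    using assms by (auto simp: L2_def)
  have "\<bar>a * b\<bar> \<le> a\<^sup>2 + b\<^sup>2" for a b :: real
    using sum_squares_bound[of "\<bar>a\<bar>" "\<bar>b\<bar>"] abs_ge_zero[of "a * b"]
    by (simp only: abs_mult power2_abs)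
  then show "AE x in Q. norm (v x * w x) \<le> norm ((v x)\<^sup>2 + (w x)\<^sup>2)"
    by (auto intro!: AE_I2)
qed

lemma L2_zero: "(\<lambda>x. 0) \<in> L2 Q"
  by (simp add: L2_def)

lemma L2_scale: "v \<in> L2 Q \<Longrightarrow> (\<lambda>x. c * v x) \<in> L2 Q"
  by (auto simp: L2_def power_mult_distrib)

lemma L2_add:
  assumes "v \<in> L2 Q" "w \<in> L2 Q"
  shows "(\<lambda>x. v x + w x) \<in> L2 Q"
  using assms L2_mult_integrable[OF assms]
  by (auto simp: L2_def power2_sum mult.assoc)

lemma L2_diff:
  assumes "v \<in> L2 Q" "w \<in> L2 Q"
  shows "(\<lambda>x. v x - w x) \<in> L2 Q"
  using L2_add[OF assms(1) L2_scale[OF assms(2), of "-1"]] by simp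

lemma L2_divide: "v \<in> L2 Q \<Longrightarrow> (\<lambda>x. v x / c) \<in> L2 Q"
  using L2_scale[of v Q "1/c"] by simp

lemma L2_sum: "(\<And>i. i \<in> I \<Longrightarrow> v i \<in> L2 Q) \<Longrightarrow> (\<lambda>x. \<Sum>i\<in>I. v i x) \<in> L2 Q"
  by (induction I rule: infinite_finite_induct) (auto intro: L2_zero L2_add)

lemmas L2_intros = L2_zero L2_scale L2_add L2_diff L2_divide L2_sum

lemma L2_inner_commute: "L2_inner Q v w = L2_inner Q w v"
  by (simp add: L2_inner_def mult.commute)

lemma L2_inner_add:
  "v \<in> L2 Q \<Longrightarrow> w \<in> L2 Q \<Longrightarrow> \<phi> \<in> L2 Q \<Longrightarrow>
     L2_inner Q (\<lambda>x. v x + w x) \<phi> = L2_inner Q v \<phi> + L2_inner Q w \<phi>"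
  unfolding L2_inner_def distrib_right by (intro Bochner_Integration.integral_add L2_mult_integrable)

lemma L2_inner_diff:
  "v \<in> L2 Q \<Longrightarrow> w \<in> L2 Q \<Longrightarrow> \<phi> \<in> L2 Q \<Longrightarrow>
     L2_inner Q (\<lambda>x. v x - w x) \<phi> = L2_inner Q v \<phi> - L2_inner Q w \<phi>"
  unfolding L2_inner_def left_diff_distrib by (intro Bochner_Integration.integral_diff L2_mult_integrable)

lemma L2_inner_scale: "L2_inner Q (\<lambda>x. c * v x) \<phi> = c * L2_inner Q v \<phi>"
  by (simp add: L2_inner_def mult.assoc)

lemma L2_inner_divide: "L2_inner Q (\<lambda>x. v x / c) \<phi> = L2_inner Q v \<phi> / c"
  using L2_inner_scale[of Q "1/c"] by simp

lemma L2_inner_zero: "L2_inner Q (\<lambda>x. 0) \<phi> = 0"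
  by (simp add: L2_inner_def)

lemma L2_inner_sum:
  "(\<And>i. i \<in> I \<Longrightarrow> v i \<in> L2 Q) \<Longrightarrow> \<phi> \<in> L2 Q \<Longrightarrow>
     L2_inner Q (\<lambda>x. \<Sum>i\<in>I. v i x) \<phi> = (\<Sum>i\<in>I. L2_inner Q (v i) \<phi>)"
  by (induction I rule: infinite_finite_induct) (auto simp: L2_inner_zero L2_inner_add L2_sum)

lemma L2_inner_cong_AE:
  assumes "AE x in Q. v x = w x" "v \<in> L2 Q" "w \<in> L2 Q" "\<phi> \<in> L2 Q"
  shows "L2_inner Q v \<phi> = L2_inner Q w \<phi>"
  unfolding L2_inner_def using assms by (intro integral_cong_AE) (auto simp: L2_def)

lemma L2_norm_nonneg: "0 \<le> L2_norm Q v"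
  by (simp add: L2_norm_def)

lemma L2_norm_square: "(L2_norm Q v)\<^sup>2 = L2_inner Q v v"
  by (simp add: L2_norm_def L2_inner_def power2_eq_square)

lemma L2_inner_self_nonneg: "0 \<le> L2_inner Q v v"
  by (simp add: L2_inner_def)

text \<open>On functions, as opposed to classes, the pairing is only positive semidefinite. The
  nonnegative form \<open>quad\<close> in two scalars also covers a second argument that has norm
  zero without being zero.\<close>

lemma L2_Cauchy_Schwarz:
  assumes v: "v \<in> L2 Q" and w: "w \<in> L2 Q"
  shows "\<bar>L2_inner Q v w\<bar> \<le> L2_norm Q v * L2_norm Q w"
proof -
  have quad: "0 \<le> b\<^sup>2 * L2_inner Q v v - 2 * a * b * L2_inner Q v w + a\<^sup>2 * L2_inner Q w w" for a b
  proof -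
    have "0 \<le> L2_inner Q (\<lambda>x. b * v x - a * w x) (\<lambda>x. b * v x - a * w x)"
      by (rule L2_inner_self_nonneg)
    also have "\<dots> = b * L2_inner Q v (\<lambda>x. b * v x - a * w x) - a * L2_inner Q w (\<lambda>x. b * v x - a * w x)"
      using v w by (simp add: L2_inner_diff L2_inner_scale L2_intros)
    also have "\<dots> = b\<^sup>2 * L2_inner Q v v - 2 * a * b * L2_inner Q v w + a\<^sup>2 * L2_inner Q w w"
      using v w
      by (simp add: L2_inner_commute[of Q _ "\<lambda>x. b * v x - a * w x"] L2_inner_diff L2_inner_scale
          L2_intros L2_inner_commute[of Q w v] power2_eq_square algebra_simps)
    finally show ?thesis .
  qed
  have "(L2_inner Q v w)\<^sup>2 \<le> L2_inner Q v v * L2_inner Q w w"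
  proof (cases "L2_inner Q w w = 0")
    case True
    \<comment> \<open>When \<open>w\<close> has norm zero, \<open>quad\<close> with
      \<open>b = 1\<close> is affine in \<open>a\<close>; a nonzero slope would let it reach the
      value \<open>-1\<close>.\<close>
    have "L2_inner Q v w = 0"
    proof (rule ccontr)
      assume nz: "L2_inner Q v w \<noteq> 0"
      have "0 \<le> L2_inner Q v v - 2 * ((L2_inner Q v v + 1) / (2 * L2_inner Q v w)) * L2_inner Q v w"
        using quad[of 1 "(L2_inner Q v v + 1) / (2 * L2_inner Q v w)"] True by simp
      also have "\<dots> = -1" using nz by (simp add: field_simps)
      finally show False by simp
    qed
    then show ?thesis using True by simp
  next
    case False
    then have pos: "0 < L2_inner Q w w"
      using L2_inner_self_nonneg[of Q w] by simp
    have "0 \<le> L2_inner Q w w * (L2_inner Q v v * L2_inner Q w w - (L2_inner Q v w)\<^sup>2)"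
      using quad[of "L2_inner Q w w" "L2_inner Q v w"]
      by (simp add: power2_eq_square algebra_simps)
    then show ?thesis using pos by (simp add: zero_le_mult_iff)
  qed
  then have "\<bar>L2_inner Q v w\<bar>\<^sup>2 \<le> (L2_norm Q v * L2_norm Q w)\<^sup>2"
    by (simp add: power_mult_distrib L2_norm_square)
  then show ?thesis
    by (rule power2_le_imp_le) (simp add: L2_norm_nonneg)
qed

section \<open>Duality, limits and derivatives of pairings\<close>

text \<open>Testing with \<open>\<phi> = v\<close> suffices. This is how estimates of real functions
  return to norms, provided that they depend on \<open>\<phi>\<close> only through its norm.\<close>

lemma L2_norm_le_dual:
  assumes "v \<in> L2 Q" "\<And>\<phi>. \<phi> \<in> L2 Q \<Longrightarrow> \<bar>L2_inner Q v \<phi>\<bar> \<le> B * L2_norm Q \<phi>" "0 \<le> B"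
  shows "L2_norm Q v \<le> B"
proof (cases "L2_norm Q v = 0")
  case False
  then have "0 < L2_norm Q v" using L2_norm_nonneg[of Q v] by simp
  moreover have "L2_norm Q v * L2_norm Q v \<le> B * L2_norm Q v"
    using assms(2)[OF assms(1)] by (simp add: L2_norm_square[symmetric] power2_eq_square)
  ultimately show ?thesis by simp
qed (simp add: assms)

lemma L2_inner_tendsto:
  assumes "((\<lambda>s. L2_norm Q (\<lambda>x. v s x - w x)) \<longlongrightarrow> 0) F"
    and "eventually (\<lambda>s. v s \<in> L2 Q) F" "w \<in> L2 Q" "\<phi> \<in> L2 Q"
  shows "((\<lambda>s. L2_inner Q (v s) \<phi>) \<longlongrightarrow> L2_inner Q w \<phi>) F"
proof (rule LIM_zero_cancel, rule Lim_null_comparison)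
  show "\<forall>\<^sub>F s in F. norm (L2_inner Q (v s) \<phi> - L2_inner Q w \<phi>)
      \<le> L2_norm Q (\<lambda>x. v s x - w x) * L2_norm Q \<phi>"
    using assms(2)
  proof eventually_elim
    case (elim s)
    then show ?case
      using L2_Cauchy_Schwarz[of "\<lambda>x. v s x - w x" Q \<phi>] assms
      by (simp add: L2_inner_diff L2_diff)
  qed
  show "((\<lambda>s. L2_norm Q (\<lambda>x. v s x - w x) * L2_norm Q \<phi>) \<longlongrightarrow> 0) F"
    using tendsto_mult_right[OF assms(1)] by simp
qed

lemma L2_continuous_on_inner:
  assumes "L2_continuous_on Q S v" "\<phi> \<in> L2 Q"
  shows "continuous_on S (\<lambda>t. L2_inner Q (v t) \<phi>)"
  unfolding continuous_on_def
proof
  fix t assume "t \<in> S"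
  then show "((\<lambda>t. L2_inner Q (v t) \<phi>) \<longlongrightarrow> L2_inner Q (v t) \<phi>) (at t within S)"
    using assms
    by (intro L2_inner_tendsto) (auto simp: L2_continuous_on_def eventually_at_filter)
qed

text \<open>By linearity the difference quotient of the pairing is the pairing with the difference
  quotient, and norm limits pass through by Cauchy-Schwarz. Taylor arguments in the function space
  thus become arguments about real functions.\<close>

lemma L2_has_derivative_on_inner:
  assumes "L2_has_derivative_on Q S v v'" "t \<in> S" "\<phi> \<in> L2 Q"
    and "\<And>s. s \<in> S \<Longrightarrow> v s \<in> L2 Q" "v' t \<in> L2 Q"
  shows "((\<lambda>t. L2_inner Q (v t) \<phi>) has_real_derivative L2_inner Q (v' t) \<phi>) (at t within S)"
proof -
  have "((\<lambda>s. L2_inner Q (\<lambda>x. (v s x - v t x) / (s - t)) \<phi>) \<longlongrightarrow> L2_inner Q (v' t) \<phi>)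
      (at t within S)"
    using assms
    by (intro L2_inner_tendsto)
      (auto simp: L2_has_derivative_on_def eventually_at_filter intro!: always_eventually L2_divide L2_diff)
  moreover have "\<forall>\<^sub>F s in at t within S. L2_inner Q (\<lambda>x. (v s x - v t x) / (s - t)) \<phi>
      = (L2_inner Q (v s) \<phi> - L2_inner Q (v t) \<phi>) / (s - t)"
    using assms by (auto simp: eventually_at_filter L2_inner_divide L2_inner_diff)
  ultimately show ?thesis
    unfolding has_field_derivative_iff by (rule Lim_transform_eventually)
qed

section \<open>Fourier coefficients in an orthonormal system\<close>

text \<open>Pythagoras: the partial sum \<open>p\<close> is an orthogonal projection of
  \<open>v\<close>, so its pairing with \<open>v\<close> equals its pairing with itself. Positivity
  of the left side gives Bessel's inequality, and letting it tend to zero gives Parseval's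
  identity.\<close>

lemma L2_Fourier_remainder:
  fixes \<omega> :: "nat \<Rightarrow> 'x \<Rightarrow> real"
  assumes "v \<in> L2 Q" "\<And>k. \<omega> k \<in> L2 Q"
    and "\<And>j k. L2_inner Q (\<omega> j) (\<omega> k) = (if j = k then 1 else 0)"
  shows "(L2_norm Q (\<lambda>x. v x - (\<Sum>k<m. L2_inner Q v (\<omega> k) * \<omega> k x)))\<^sup>2
      = (L2_norm Q v)\<^sup>2 - (\<Sum>k<m. (L2_inner Q v (\<omega> k))\<^sup>2)"
proof -
  define p where "p = (\<lambda>x. \<Sum>k<m. L2_inner Q v (\<omega> k) * \<omega> k x)"
  have p: "p \<in> L2 Q"
    unfolding p_def by (intro L2_intros assms)
  have inner_p: "L2_inner Q p \<phi> = (\<Sum>k<m. L2_inner Q v (\<omega> k) * L2_inner Q (\<omega> k) \<phi>)"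
    if "\<phi> \<in> L2 Q" for \<phi>
    unfolding p_def using that assms by (simp add: L2_inner_sum L2_inner_scale L2_intros)
  have p_omega: "L2_inner Q p (\<omega> j) = L2_inner Q v (\<omega> j)" if "j < m" for j
  proof -
    have "L2_inner Q p (\<omega> j) = (\<Sum>k<m. if j = k then L2_inner Q v (\<omega> k) else 0)"
      unfolding inner_p[OF assms(2)] assms(3) by (intro sum.cong) auto
    then show ?thesis using that by simp
  qed
  have pv: "L2_inner Q p v = (\<Sum>k<m. (L2_inner Q v (\<omega> k))\<^sup>2)"
    unfolding inner_p[OF assms(1)] by (simp add: L2_inner_commute[of Q _ v] power2_eq_square)
  have pp: "L2_inner Q p p = (\<Sum>k<m. (L2_inner Q v (\<omega> k))\<^sup>2)"
    unfolding inner_p[OF p] by (simp add: L2_inner_commute[of Q _ p] p_omega power2_eq_square)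
  have "L2_inner Q (\<lambda>x. v x - p x) (\<lambda>x. v x - p x)
      = L2_inner Q (\<lambda>x. v x - p x) v - L2_inner Q (\<lambda>x. v x - p x) p"
    using L2_inner_diff[OF assms(1) p L2_diff[OF assms(1) p]]
    by (simp only: L2_inner_commute[of Q v "\<lambda>x. v x - p x"] L2_inner_commute[of Q p "\<lambda>x. v x - p x"])
  also have "\<dots> = L2_inner Q v v - 2 * L2_inner Q p v + L2_inner Q p p"
    unfolding L2_inner_diff[OF assms(1) p assms(1)] L2_inner_diff[OF assms(1) p p]
    by (simp add: L2_inner_commute[of Q v p])
  finally have "L2_inner Q (\<lambda>x. v x - p x) (\<lambda>x. v x - p x)
      = L2_inner Q v v - 2 * L2_inner Q p v + L2_inner Q p p" .
  then show ?thesis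
    using pv pp by (simp add: L2_norm_square p_def)
qed

lemma L2_Bessel:
  fixes \<omega> :: "nat \<Rightarrow> 'x \<Rightarrow> real"
  assumes "v \<in> L2 Q" "\<And>k. \<omega> k \<in> L2 Q"
    and "\<And>j k. L2_inner Q (\<omega> j) (\<omega> k) = (if j = k then 1 else 0)"
  shows "L2_set (\<lambda>k. L2_inner Q v (\<omega> k)) {..<m} \<le> L2_norm Q v"
  using L2_Fourier_remainder[OF assms, of m]
    zero_le_power2[of "L2_norm Q (\<lambda>x. v x - (\<Sum>k<m. L2_inner Q v (\<omega> k) * \<omega> k x))"]
  by (auto simp: L2_set_def intro!: real_le_lsqrt L2_norm_nonneg)

text \<open>The remainders tend to zero, so by Pythagoras the squared norm is the limit of the sums
  of squared coefficients, which \<open>B\<close> controls uniformly in \<open>m\<close>.\<close>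

lemma L2_norm_le_Fourier:
  fixes \<omega> :: "nat \<Rightarrow> 'x \<Rightarrow> real"
  assumes "v \<in> L2 Q" "\<And>k. \<omega> k \<in> L2 Q"
    and "\<And>j k. L2_inner Q (\<omega> j) (\<omega> k) = (if j = k then 1 else 0)"
    and "(\<lambda>n. L2_norm Q (\<lambda>x. v x - (\<Sum>k<n. L2_inner Q v (\<omega> k) * \<omega> k x))) \<longlonglongrightarrow> 0"
    and "\<And>m. L2_set (\<lambda>k. L2_inner Q v (\<omega> k)) {..<m} \<le> B"
  shows "L2_norm Q v \<le> B"
proof -
  have B: "0 \<le> B" using assms(5)[of 0] by simp
  have "(\<lambda>n. (L2_norm Q v)\<^sup>2 - (\<Sum>k<n. (L2_inner Q v (\<omega> k))\<^sup>2)) \<longlonglongrightarrow> 0"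
    using tendsto_power[OF assms(4), of 2] by (simp add: L2_Fourier_remainder[OF assms(1-3)])
  then have "(L2_norm Q v)\<^sup>2 - B\<^sup>2 \<le> 0"
  proof (rule Lim_bounded2[where N = 0], intro allI impI)
    fix n
    have "(L2_set (\<lambda>k. L2_inner Q v (\<omega> k)) {..<n})\<^sup>2 \<le> B\<^sup>2"
      by (intro power_mono assms) simp
    then show "(L2_norm Q v)\<^sup>2 - B\<^sup>2 \<le> (L2_norm Q v)\<^sup>2 - (\<Sum>k<n. (L2_inner Q v (\<omega> k))\<^sup>2)"
      by (simp add: L2_set_def sum_nonneg)
  qed
  then show ?thesis using B by (auto intro: power2_le_imp_le)
qed

section \<open>The Dirichlet Laplacian\<close>

abbreviation R_space :: "nat \<Rightarrow> (nat \<Rightarrow> real) measure" where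
  "R_space d \<equiv> (\<Pi>\<^sub>M i\<in>{..<d}. (lborel :: real measure))"

lemma topspace_Rn_top: "topspace (Rn_top d) = (\<Pi>\<^sub>E i\<in>{..<d}. UNIV)"
  by (simp add: Rn_top_def)

lemma space_R_space: "space (R_space d) = (\<Pi>\<^sub>E i\<in>{..<d}. UNIV)"
  by (simp add: space_PiM)

text \<open>Extension by zero embeds the extensional functions into the total functions, a
  topological type whose Borel sets are those of the countable product. Restriction is a continuous
  left inverse, so topological facts carry over to measurability.\<close>

lemma measurable_R_space_extend:
  "(\<lambda>x i. if i < d then x i else 0) \<in> R_space d \<rightarrow>\<^sub>M (borel :: (nat \<Rightarrow> real) measure)"
proof -
  have "(\<lambda>x i. if i < d then x i else 0) \<in> R_space d \<rightarrow>\<^sub>M Pi\<^sub>M UNIV (\<lambda>_::nat. borel :: real measure)"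
  proof (rule measurable_PiM_single')
    show "(\<lambda>x. if i < d then x i else 0) \<in> R_space d \<rightarrow>\<^sub>M borel" for i
    proof (cases "i < d")
      case True
      then have "(\<lambda>x. x i) \<in> R_space d \<rightarrow>\<^sub>M lborel"
        by (intro measurable_component_singleton) simp
      then show ?thesis using True by simp
    qed simp
  qed auto
  then show ?thesis
    using sets_PiM_equal_borel measurable_cong_sets by blast
qed

lemma continuous_map_restrict_Rn_top:
  "continuous_map euclidean (Rn_top d) (\<lambda>y. restrict y {..<d})"
  by (auto simp: Rn_top_def continuous_map_componentwise intro!: continuous_intros)

lemma restrict_extend:
  "x \<in> (\<Pi>\<^sub>E i\<in>{..<d}. UNIV) \<Longrightarrow> restrict (\<lambda>i. if i < d then x i else 0) {..<d} = x"
  by (auto simp: fun_eq_iff PiE_def extensional_def)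

text \<open>\<open>\<phi>\<close> factors as extension by zero followed by a continuous function of
  total functions.\<close>

lemma continuous_map_Rn_top_measurable:
  assumes "continuous_map (Rn_top d) euclideanreal \<phi>"
  shows "\<phi> \<in> borel_measurable (R_space d)"
proof -
  have "continuous_on UNIV (\<lambda>y. \<phi> (restrict y {..<d}))"
    using continuous_map_compose[OF continuous_map_restrict_Rn_top assms] by (simp add: o_def)
  then have "(\<lambda>y. \<phi> (restrict y {..<d})) \<in> borel_measurable borel"
    by (rule borel_measurable_continuous_onI)
  from measurable_compose[OF measurable_R_space_extend this]
  have "(\<lambda>x. \<phi> (restrict (\<lambda>i. if i < d then x i else 0) {..<d})) \<in> borel_measurable (R_space d)" .
  then show ?thesis
    by (rule measurable_cong[THEN iffD1, rotated]) (simp add: restrict_extend space_R_space)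
qed

lemma openin_Rn_top_sets:
  assumes "openin (Rn_top d) \<Omega>"
  shows "\<Omega> \<in> sets (R_space d)"
proof -
  have sub: "\<Omega> \<subseteq> (\<Pi>\<^sub>E i\<in>{..<d}. UNIV)"
    using openin_subset[OF assms] by (simp add: topspace_Rn_top)
  have "open {y. restrict y {..<d} \<in> \<Omega>}"
    using openin_continuous_map_preimage[OF continuous_map_restrict_Rn_top assms] by simp
  then have "{y. restrict y {..<d} \<in> \<Omega>} \<in> sets borel" by simp
  note measurable_sets[OF measurable_R_space_extend[of d] this]
  moreover have "(\<lambda>x i. if i < d then x i else 0) -` {y. restrict y {..<d} \<in> \<Omega>} \<inter> space (R_space d) = \<Omega>"
    using sub by (auto simp: restrict_extend space_R_space)
  ultimately show ?thesis by (simp only:)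
qed

lemma bounded_domain_in_box:
  assumes "bounded_domain d \<Omega>"
  obtains B where "\<Omega> \<subseteq> (\<Pi>\<^sub>E i\<in>{..<d}. {- B..B})"
proof -
  obtain B where B: "\<forall>x\<in>\<Omega>. \<forall>i<d. \<bar>x i\<bar> \<le> B" and "openin (Rn_top d) \<Omega>"
    using assms by (auto simp: bounded_domain_def)
  then have ext: "x \<in> (\<Pi>\<^sub>E i\<in>{..<d}. UNIV)" if "x \<in> \<Omega>" for x
    using that openin_subset[of "Rn_top d" \<Omega>] by (auto simp: topspace_Rn_top)
  have "x \<in> (\<Pi>\<^sub>E i\<in>{..<d}. {- B..B})" if "x \<in> \<Omega>" for x
  proof -
    have "- B \<le> x i \<and> x i \<le> B" if "i < d" for i
      using B \<open>x \<in> \<Omega>\<close> that by (simp add: abs_le_iff minus_le_iff)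
    then show ?thesis
      using ext[OF that] by (simp add: PiE_iff)
  qed
  then show ?thesis using that by blast
qed

lemma bounded_domain_sets: "bounded_domain d \<Omega> \<Longrightarrow> \<Omega> \<in> sets (R_space d)"
  by (simp add: bounded_domain_def openin_Rn_top_sets)

lemma space_leb_on: "bounded_domain d \<Omega> \<Longrightarrow> space (leb_on d \<Omega>) = \<Omega>"
  using sets.sets_into_space[OF bounded_domain_sets]
  by (auto simp: leb_on_def space_restrict_space)

lemma finite_measure_leb_on:
  assumes "bounded_domain d \<Omega>"
  shows "finite_measure (leb_on d \<Omega>)"
proof -
  interpret product_sigma_finite "\<lambda>_::nat. lborel :: real measure"
    by (simp add: product_sigma_finite_def lborel.sigma_finite_measure_axioms)
  obtain B where B: "\<Omega> \<subseteq> (\<Pi>\<^sub>E i\<in>{..<d}. {- B..B})"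
    using bounded_domain_in_box[OF assms] .
  have "emeasure (leb_on d \<Omega>) (space (leb_on d \<Omega>)) = emeasure (R_space d) \<Omega>"
    using bounded_domain_sets[OF assms] assms
    by (simp add: space_leb_on) (simp add: leb_on_def emeasure_restrict_space)
  also have "\<dots> \<le> emeasure (R_space d) (\<Pi>\<^sub>E i\<in>{..<d}. {- B..B})"
    using B by (intro emeasure_mono sets_PiM_I_finite) auto
  also have "\<dots> = (\<Prod>i<d. ennreal (if 0 \<le> B then 2 * B else 0))"
    by (subst emeasure_PiM) auto
  also have "\<dots> < \<infinity>"
    by (simp add: ennreal_power less_top[symmetric])
  finally show ?thesis
    by (intro finite_measureI) auto
qed

text \<open>The closed box around the domain is compact in the product topology, so
  \<open>\<phi>\<close> is bounded on it, and bounded functions are square integrable for a finite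
  measure.\<close>

lemma continuous_map_Rn_top_L2:
  assumes "bounded_domain d \<Omega>" "continuous_map (Rn_top d) euclideanreal \<phi>"
  shows "\<phi> \<in> L2 (leb_on d \<Omega>)"
proof -
  interpret finite_measure "leb_on d \<Omega>"
    using assms(1) by (rule finite_measure_leb_on)
  obtain B where B: "\<Omega> \<subseteq> (\<Pi>\<^sub>E i\<in>{..<d}. {- B..B})"
    using bounded_domain_in_box[OF assms(1)] .
  have "compactin (Rn_top d) (\<Pi>\<^sub>E i\<in>{..<d}. {- B..B})"
    unfolding Rn_top_def by (simp add: compactin_PiE)
  from image_compactin[OF this assms(2)]
  have "bounded (\<phi> ` (\<Pi>\<^sub>E i\<in>{..<d}. {- B..B}))"
    by (simp add: compact_imp_bounded)
  then obtain K where K: "\<And>x. x \<in> (\<Pi>\<^sub>E i\<in>{..<d}. {- B..B}) \<Longrightarrow> \<bar>\<phi> x\<bar> \<le> K"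
    by (auto simp: bounded_iff)
  have meas: "\<phi> \<in> borel_measurable (leb_on d \<Omega>)"
    unfolding leb_on_def
    by (intro measurable_restrict_space1 measurable_completion continuous_map_Rn_top_measurable assms)
  have "integrable (leb_on d \<Omega>) (\<lambda>x. (\<phi> x)\<^sup>2)"
  proof (rule integrable_const_bound)
    show "AE x in leb_on d \<Omega>. norm ((\<phi> x)\<^sup>2) \<le> K\<^sup>2"
    proof (rule AE_I2)
      fix x assume "x \<in> space (leb_on d \<Omega>)"
      then have "\<bar>\<phi> x\<bar> \<le> K" using B K assms(1) by (auto simp: space_leb_on)
      then show "norm ((\<phi> x)\<^sup>2) \<le> K\<^sup>2"
        using power_mono[of "\<bar>\<phi> x\<bar>" K 2] by simp
    qed
  qed (use meas in measurable)
  then show ?thesis using meas by (simp add: L2_def)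
qed

lemma test_function_L2:
  assumes "bounded_domain d \<Omega>" "test_function d \<Omega> \<phi>"
  shows "\<phi> \<in> L2 (leb_on d \<Omega>)" and "i < d \<Longrightarrow> partial_deriv i \<phi> \<in> L2 (leb_on d \<Omega>)"
proof -
  have "C_k d 0 \<phi>" "C_k d (Suc 0) \<phi>"
    using assms(2) by (auto simp: test_function_def simp del: C_k.simps)
  then show "\<phi> \<in> L2 (leb_on d \<Omega>)" "i < d \<Longrightarrow> partial_deriv i \<phi> \<in> L2 (leb_on d \<Omega>)"
    using assms(1) by (auto intro!: continuous_map_Rn_top_L2)
qed

section \<open>Green's formula and diagonalization of the Laplacian\<close>

text \<open>Density: test functions approximate \<open>v\<close> together with its gradient
  \<open>H\<close>, and both sides of the weak equation survive the limit because pairings are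
  continuous in the norm.\<close>

lemma H10_Green:
  assumes dom: "bounded_domain d \<Omega>"
    and w: "w \<in> L2 (leb_on d \<Omega>)"
    and G: "\<And>i. i < d \<Longrightarrow> G i \<in> L2 (leb_on d \<Omega>)"
    and weak: "\<And>\<phi>. test_function d \<Omega> \<phi> \<Longrightarrow>
         (\<Sum>i<d. L2_inner (leb_on d \<Omega>) (G i) (partial_deriv i \<phi>)) = - L2_inner (leb_on d \<Omega>) w \<phi>"
    and v: "H10_gradient d \<Omega> v H"
  shows "(\<Sum>i<d. L2_inner (leb_on d \<Omega>) (H i) (G i)) = - L2_inner (leb_on d \<Omega>) v w"
proof -
  let ?Q = "leb_on d \<Omega>"
  obtain \<phi> where \<phi>: "\<And>k. test_function d \<Omega> (\<phi> k)"
    "(\<lambda>k. L2_norm ?Q (\<lambda>x. \<phi> k x - v x)) \<longlonglongrightarrow> 0"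
    "\<And>i. i < d \<Longrightarrow> (\<lambda>k. L2_norm ?Q (\<lambda>x. partial_deriv i (\<phi> k) x - H i x)) \<longlonglongrightarrow> 0"
    and v': "v \<in> L2 ?Q" "\<And>i. i < d \<Longrightarrow> H i \<in> L2 ?Q"
    using v unfolding H10_gradient_def by blast
  have "(\<lambda>k. L2_inner ?Q (partial_deriv i (\<phi> k)) (G i)) \<longlonglongrightarrow> L2_inner ?Q (H i) (G i)" if "i < d" for i
    by (rule L2_inner_tendsto)
      (use that v' G \<phi>(3) test_function_L2(2)[OF dom \<phi>(1)] in simp_all)
  then have "(\<lambda>k. \<Sum>i<d. L2_inner ?Q (partial_deriv i (\<phi> k)) (G i))
      \<longlonglongrightarrow> (\<Sum>i<d. L2_inner ?Q (H i) (G i))"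
    by (intro tendsto_sum) auto
  moreover have "(\<lambda>k. L2_inner ?Q (\<phi> k) w) \<longlonglongrightarrow> L2_inner ?Q v w"
    by (rule L2_inner_tendsto) (use v' w \<phi>(2) test_function_L2(1)[OF dom \<phi>(1)] in simp_all)
  then have "(\<lambda>k. - L2_inner ?Q (\<phi> k) w) \<longlonglongrightarrow> - L2_inner ?Q v w"
    by (rule tendsto_minus)
  moreover have "(\<Sum>i<d. L2_inner ?Q (partial_deriv i (\<phi> k)) (G i)) = - L2_inner ?Q (\<phi> k) w" for k
    using weak[OF \<phi>(1)] by (simp add: L2_inner_commute)
  ultimately show ?thesis
    by (auto intro: LIMSEQ_unique)
qed

lemma dirichlet_laplacian_L2:
  assumes "dirichlet_laplacian d \<Omega> v w"
  shows "v \<in> L2 (leb_on d \<Omega>)" "w \<in> L2 (leb_on d \<Omega>)"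
  using assms by (auto simp: dirichlet_laplacian_def H10_gradient_def)

text \<open>Green's formula is used twice, testing the weak equation of each function with the other
  one; both times the same pairing of gradients appears.\<close>

lemma dirichlet_laplacian_symmetric:
  assumes "bounded_domain d \<Omega>" "dirichlet_laplacian d \<Omega> v w" "dirichlet_laplacian d \<Omega> v' w'"
  shows "L2_inner (leb_on d \<Omega>) w v' = L2_inner (leb_on d \<Omega>) v w'"
proof -
  let ?Q = "leb_on d \<Omega>"
  obtain G where G: "H10_gradient d \<Omega> v G" "\<And>\<phi>. test_function d \<Omega> \<phi> \<Longrightarrow>
         (\<Sum>i<d. L2_inner ?Q (G i) (partial_deriv i \<phi>)) = - L2_inner ?Q w \<phi>"
    using assms(2) by (auto simp: dirichlet_laplacian_def)
  obtain G' where G': "H10_gradient d \<Omega> v' G'" "\<And>\<phi>. test_function d \<Omega> \<phi> \<Longrightarrow>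
         (\<Sum>i<d. L2_inner ?Q (G' i) (partial_deriv i \<phi>)) = - L2_inner ?Q w' \<phi>"
    using assms(3) by (auto simp: dirichlet_laplacian_def)
  have "(\<Sum>i<d. L2_inner ?Q (G' i) (G i)) = - L2_inner ?Q v' w"
    by (rule H10_Green[OF assms(1) dirichlet_laplacian_L2(2)[OF assms(2)] _ G(2) G'(1)])
      (use G(1) in \<open>simp_all add: H10_gradient_def\<close>)
  moreover have "(\<Sum>i<d. L2_inner ?Q (G i) (G' i)) = - L2_inner ?Q v w'"
    by (rule H10_Green[OF assms(1) dirichlet_laplacian_L2(2)[OF assms(3)] _ G'(2) G(1)])
      (use G'(1) in \<open>simp_all add: H10_gradient_def\<close>)
  ultimately show ?thesis by (simp add: L2_inner_commute)
qed

lemma dirichlet_eigenfunction_L2: "dirichlet_eigenfunction d \<Omega> \<mu> \<omega> \<Longrightarrow> \<omega> \<in> L2 (leb_on d \<Omega>)"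
  by (auto simp: dirichlet_eigenfunction_def dirichlet_laplacian_L2)

text \<open>Symmetry moves the Laplacian onto the eigenfunction. Taking coefficients in the
  eigenbasis therefore decouples the scheme into scalar recursions.\<close>

lemma dirichlet_laplacian_eigenfunction:
  assumes "bounded_domain d \<Omega>" "dirichlet_laplacian d \<Omega> v w" "dirichlet_eigenfunction d \<Omega> \<mu> \<omega>"
  shows "L2_inner (leb_on d \<Omega>) w \<omega> = - \<mu> * L2_inner (leb_on d \<Omega>) v \<omega>"
proof -
  let ?Q = "leb_on d \<Omega>"
  obtain w' where w': "dirichlet_laplacian d \<Omega> \<omega> w'" "AE x in ?Q. - w' x = \<mu> * \<omega> x"
    using assms(3) by (auto simp: dirichlet_eigenfunction_def)
  have "AE x in ?Q. w' x = - \<mu> * \<omega> x"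
    using w'(2) by eventually_elim simp
  then have "L2_inner ?Q w' v = L2_inner ?Q (\<lambda>x. - \<mu> * \<omega> x) v"
    using dirichlet_laplacian_L2[OF assms(2)] dirichlet_laplacian_L2[OF w'(1)]
    by (intro L2_inner_cong_AE L2_scale)
  then show ?thesis
    using dirichlet_laplacian_symmetric[OF assms(1,2) w'(1)]
    by (simp only: L2_inner_scale L2_inner_commute[of ?Q v])
qed

section \<open>The two-step backward differentiation formula\<close>

text \<open>Both \<open>G - f\<close> and \<open>G + f\<close> are nondecreasing. Derivatives enter
  only inside the interval, which admits a singular one at the left end and a one-sided one at the
  right end.\<close>

lemma increment_le_of_deriv_le:
  fixes f G :: "real \<Rightarrow> real"
  assumes "a \<le> b" "continuous_on {a..b} f" "continuous_on {a..b} G"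
    and "\<And>x. a < x \<Longrightarrow> x < b \<Longrightarrow> (f has_real_derivative f' x) (at x)"
    and "\<And>x. a < x \<Longrightarrow> x < b \<Longrightarrow> (G has_real_derivative G' x) (at x)"
    and "\<And>x. a < x \<Longrightarrow> x < b \<Longrightarrow> \<bar>f' x\<bar> \<le> G' x"
  shows "\<bar>f b - f a\<bar> \<le> G b - G a"
proof -
  have "G a - f a \<le> G b - f b"
  proof (rule DERIV_nonneg_imp_increasing_open[OF assms(1)])
    fix x assume x: "a < x" "x < b"
    have "((\<lambda>x. G x - f x) has_real_derivative G' x - f' x) (at x)"
      using x assms by (intro DERIV_diff) auto
    moreover have "0 \<le> G' x - f' x"
      using assms(6)[OF x] by linarith
    ultimately show "\<exists>y. ((\<lambda>x. G x - f x) has_real_derivative y) (at x) \<and> 0 \<le> y"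
      by blast
  qed (intro continuous_on_diff assms)
  moreover have "G a + f a \<le> G b + f b"
  proof (rule DERIV_nonneg_imp_increasing_open[OF assms(1)])
    fix x assume x: "a < x" "x < b"
    have "((\<lambda>x. G x + f x) has_real_derivative G' x + f' x) (at x)"
      using x assms by (intro DERIV_add) auto
    moreover have "0 \<le> G' x + f' x"
      using assms(6)[OF x] by linarith
    ultimately show "\<exists>y. ((\<lambda>x. G x + f x) has_real_derivative y) (at x) \<and> 0 \<le> y"
      by blast
  qed (intro continuous_on_add assms)
  ultimately show ?thesis by linarith
qed

text \<open>With \<open>b\<close> fixed, the defect is a function \<open>F\<close> of the step
  length. \<open>F\<close> and its derivative vanish at zero, and its second derivative is
  \<open>2 * (g2 (b - 2 * s) - g2 (b - s))\<close>; successive comparison with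
  \<open>2 * B * s\<close>, \<open>B * s\<^sup>2\<close> and \<open>B * s ^ 3 / 3\<close> gives the
  third order.\<close>

lemma BDF2_truncation_smooth:
  fixes g0 g1 g2 g3 :: "real \<Rightarrow> real"
  assumes h: "0 < h"
    and cont: "continuous_on {b - 2 * h..b} g0" "continuous_on {b - 2 * h..b} g1"
      "continuous_on {b - 2 * h..b} g2"
    and D: "\<And>t. b - 2 * h < t \<Longrightarrow> t < b \<Longrightarrow> (g0 has_real_derivative g1 t) (at t)"
      "\<And>t. b - 2 * h < t \<Longrightarrow> t < b \<Longrightarrow> (g1 has_real_derivative g2 t) (at t)"
      "\<And>t. b - 2 * h < t \<Longrightarrow> t < b \<Longrightarrow> (g2 has_real_derivative g3 t) (at t)"
    and bound: "\<And>t. b - 2 * h < t \<Longrightarrow> t < b \<Longrightarrow> \<bar>g3 t\<bar> \<le> B"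
  shows "\<bar>3/2 * g0 b - 2 * g0 (b - h) + 1/2 * g0 (b - 2 * h) - h * g1 b\<bar> \<le> B * h ^ 3 / 3"
proof -
  have cont_sub: "continuous_on {0..r} (\<lambda>s. f (b - c * s))"
    if "continuous_on {b - 2 * h..b} f" "r \<le> h" "0 \<le> c" "c \<le> 2" for f :: "real \<Rightarrow> real" and r c
  proof (rule continuous_on_compose2[OF that(1)])
    show "(\<lambda>s. b - c * s) ` {0..r} \<subseteq> {b - 2 * h..b}"
    proof clarsimp
      fix s assume "0 \<le> s" "s \<le> r"
      then show "c * s \<le> 2 * h \<and> 0 \<le> c * s"
        using that mult_mono[of c 2 s h] by auto
    qed
  qed (auto intro!: continuous_intros)
  have second: "\<bar>g2 (b - s) - g2 (b - 2 * s)\<bar> \<le> B * s" if "0 < s" "s < h" for s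
  proof -
    have "\<bar>g2 (b - s) - g2 (b - 2 * s)\<bar> \<le> B * (b - s) - B * (b - 2 * s)"
    proof (rule increment_le_of_deriv_le[where G = "\<lambda>t. B * t"])
      show "continuous_on {b - 2 * s..b - s} g2"
        using that by (intro continuous_on_subset[OF cont(3)]) auto
      show "((\<lambda>t. B * t) has_real_derivative B) (at x)" for x
        by (auto intro!: derivative_eq_intros)
      show "(g2 has_real_derivative g3 x) (at x)" if "b - 2 * s < x" "x < b - s" for x
        using that \<open>0 < s\<close> \<open>s < h\<close> by (intro D) auto
    qed (use that bound in \<open>auto intro!: continuous_intros\<close>)
    then show ?thesis by (simp add: algebra_simps)
  qed
  \<comment> \<open>The explicit factor \<open>1\<close> gives both shifts the shape
    \<open>b - c * s\<close> that \<open>cont_sub\<close> expects.\<close>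
  define F' where "F' = (\<lambda>s. 2 * g1 (b - 1 * s) - g1 (b - 2 * s) - g1 b)"
  have first: "\<bar>F' s\<bar> \<le> B * s\<^sup>2" if s: "0 < s" "s < h" for s
  proof -
    have "\<bar>F' s - F' 0\<bar> \<le> B * s\<^sup>2 - B * 0\<^sup>2"
    proof (rule increment_le_of_deriv_le[where G = "\<lambda>t. B * t\<^sup>2"])
      show "continuous_on {0..s} F'"
        unfolding F'_def using s by (intro continuous_intros cont_sub cont) auto
      show "(F' has_real_derivative - 2 * g2 (b - x) + 2 * g2 (b - 2 * x)) (at x)"
        if "0 < x" "x < s" for x
      proof -
        have "((\<lambda>s. g1 (b - 1 * s)) has_real_derivative g2 (b - 1 * x) * - 1) (at x)"
          using that s by (intro DERIV_chain2[OF D(2)]) (auto intro!: derivative_eq_intros)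
        moreover have "((\<lambda>s. g1 (b - 2 * s)) has_real_derivative g2 (b - 2 * x) * - 2) (at x)"
          using that s by (intro DERIV_chain2[OF D(2)]) (auto intro!: derivative_eq_intros)
        ultimately show ?thesis
          unfolding F'_def by (auto intro!: derivative_eq_intros)
      qed
      show "((\<lambda>t. B * t\<^sup>2) has_real_derivative B * (2 * x)) (at x)" for x
        by (auto intro!: derivative_eq_intros)
      show "\<bar>- 2 * g2 (b - x) + 2 * g2 (b - 2 * x)\<bar> \<le> B * (2 * x)" if "0 < x" "x < s" for x
        using second[of x] that s by (simp add: abs_le_iff)
    qed (use s in \<open>auto intro!: continuous_intros\<close>)
    then show ?thesis by (simp add: F'_def)
  qed
  define F where "F = (\<lambda>s. 3/2 * g0 b - 2 * g0 (b - 1 * s) + 1/2 * g0 (b - 2 * s) - s * g1 b)"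
  have "\<bar>F h - F 0\<bar> \<le> B * h ^ 3 / 3 - B * 0 ^ 3 / 3"
  proof (rule increment_le_of_deriv_le[where G = "\<lambda>t. B * t ^ 3 / 3"])
    show "continuous_on {0..h} F"
      unfolding F_def using h by (intro continuous_intros cont_sub cont) auto
    show "(F has_real_derivative F' x) (at x)" if "0 < x" "x < h" for x
    proof -
      have "((\<lambda>s. g0 (b - 1 * s)) has_real_derivative g1 (b - 1 * x) * - 1) (at x)"
        using that by (intro DERIV_chain2[OF D(1)]) (auto intro!: derivative_eq_intros)
      moreover have "((\<lambda>s. g0 (b - 2 * s)) has_real_derivative g1 (b - 2 * x) * - 2) (at x)"
        using that by (intro DERIV_chain2[OF D(1)]) (auto intro!: derivative_eq_intros)
      ultimately show ?thesis
        unfolding F_def F'_def by (auto intro!: derivative_eq_intros)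
    qed
    show "((\<lambda>t. B * t ^ 3 / 3) has_real_derivative B * x\<^sup>2) (at x)" for x
      by (auto intro!: derivative_eq_intros)
  qed (use h first in \<open>auto intro!: continuous_intros\<close>)
  then show ?thesis by (simp add: F_def)
qed

section \<open>Stability of the recursion\<close>

text \<open>The characteristic polynomial is \<open>(3/2 + z) * X\<^sup>2 - 2 * X + 1/2\<close>. If
  \<open>s\<^sup>2 = 1 - 2 * z\<close>, then \<open>(2 - s) * (2 + s) = 2 * (3/2 + z)\<close>, and
  the roots are the inverses of the two factors. Their bounds must be uniform in
  \<open>z \<ge> z0\<close>, because the spectrum is unbounded; the roots become complex for large
  \<open>z\<close>.\<close>

lemma BDF2_characteristic_roots:
  fixes z z0 :: real
  assumes "0 < z0" "z0 < 1/4" "z0 \<le> z"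
  obtains \<xi>\<^sub>1 \<xi>\<^sub>2 :: complex
  where "(3/2 + of_real z) * (\<xi>\<^sub>1 + \<xi>\<^sub>2) = 2" "(3/2 + of_real z) * (\<xi>\<^sub>1 * \<xi>\<^sub>2) = 1/2"
    "cmod \<xi>\<^sub>1 \<le> exp (- (3/4 * z0))" "cmod \<xi>\<^sub>2 \<le> 1/2"
proof -
  \<comment> \<open>The rate \<open>3/4\<close> keeps a reserve over the final rate
    \<open>1/2\<close>. Since \<open>z0 < 1/4\<close>, the remaining \<open>1/4 * z0\<close> absorbs
    the quadratic term.\<close>
  have "exp (3/4 * z0) \<le> 1 + 3/4 * z0 + (3/4 * z0)\<^sup>2"
    using assms by (intro exp_bound) auto
  also have "\<dots> \<le> 1 + z0"
  proof -
    have "z0 * z0 \<le> 1/4 * z0" using assms by (intro mult_right_mono) auto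
    moreover have "(3/4 * z0)\<^sup>2 = 9/16 * (z0 * z0)" by (simp add: power2_eq_square)
    ultimately show ?thesis using assms(1) by linarith
  qed
  finally have exp_le: "exp (3/4 * z0) \<le> 1 + z0" .
  have inverse_le: "1 / a \<le> exp (- (3/4 * z0))" if "1 + z0 \<le> a" for a
    unfolding exp_minus inverse_eq_divide using exp_le that assms(1)
    by (intro divide_left_mono mult_pos_pos) auto
  define s where "s = csqrt (of_real (1 - 2 * z))"
  have ss: "s * s = of_real (1 - 2 * z)"
    by (simp add: s_def power2_eq_square[symmetric])
  have Re_s: "0 \<le> Re s" "Re s \<le> 1 - z0"
  proof -
    show "0 \<le> Re s"
      unfolding s_def using csqrt_principal by (metis less_eq_real_def)
    show "Re s \<le> 1 - z0"
    \<comment> \<open>Up to \<open>1/2\<close> the root \<open>s\<close> is real and at most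
      \<open>1 - z\<close>, as \<open>(1 - z)\<^sup>2 = 1 - 2 * z + z\<^sup>2\<close>; beyond that
      it is purely imaginary.\<close>
    proof (cases "z \<le> 1/2")
      case True
      have "sqrt (1 - 2 * z) \<le> 1 - z"
        using True by (intro real_le_lsqrt) (auto simp: power2_eq_square algebra_simps)
      then show ?thesis using True assms by (simp add: s_def csqrt_of_real_nonneg)
    next
      case False
      then show ?thesis using assms by (simp add: s_def csqrt_of_real_nonpos)
    qed
  qed
  have le: "2 \<le> cmod (2 + s)" "1 + z0 \<le> cmod (2 - s)"
    using complex_Re_le_cmod[of "2 + s"] complex_Re_le_cmod[of "2 - s"] Re_s by auto
  have nz: "2 + s \<noteq> 0" "2 - s \<noteq> 0"
    using le assms by auto
  have prod: "(2 - s) * (2 + s) = 2 * (3/2 + of_real z)"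
    using ss by (simp add: algebra_simps)
  show ?thesis
  proof (rule that[of "1 / (2 - s)" "1 / (2 + s)"])
    have "2 * ((3/2 + of_real z) * (1 / (2 - s) + 1 / (2 + s)))
        = (2 - s) * (2 + s) * (1 / (2 - s) + 1 / (2 + s))"
      by (simp only: prod mult.assoc)
    also have "\<dots> = (2 + s) * ((2 - s) * (1 / (2 - s))) + (2 - s) * ((2 + s) * (1 / (2 + s)))"
    proof -
      have "a * b * (1 / a + 1 / b) = b * (a * (1 / a)) + a * (b * (1 / b))" for a b :: complex
        by (simp only: distrib_left mult_ac)
      then show ?thesis .
    qed
    also have "\<dots> = 2 * 2" using nz by simp
    finally show "(3/2 + of_real z) * (1 / (2 - s) + 1 / (2 + s)) = 2" by simp
    have "2 * ((3/2 + of_real z) * (1 / (2 - s) * (1 / (2 + s))))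
        = (2 - s) * (2 + s) * (1 / (2 - s) * (1 / (2 + s)))"
      by (simp only: prod mult.assoc)
    also have "\<dots> = ((2 - s) * (1 / (2 - s))) * ((2 + s) * (1 / (2 + s)))"
    proof -
      have "a * b * (1 / a * (1 / b)) = (a * (1 / a)) * (b * (1 / b))" for a b :: complex
        by (simp only: mult_ac)
      then show ?thesis .
    qed
    also have "\<dots> = 2 * (1/2)" using nz by simp
    finally show "(3/2 + of_real z) * (1 / (2 - s) * (1 / (2 + s))) = 1/2"
      by (rule mult_left_cancel[THEN iffD1, rotated]) simp
    show "cmod (1 / (2 - s)) \<le> exp (- (3/4 * z0))"
      using inverse_le[OF le(2)] by (simp add: norm_divide)
    show "cmod (1 / (2 + s)) \<le> 1/2"
      using le(1) by (simp add: norm_divide divide_simps)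
  qed
qed

text \<open>The recursion is factored: \<open>y n = x n - \<xi>\<^sub>2 * x (n - 1)\<close> obeys a
  first-order recursion with factor \<open>\<xi>\<^sub>1\<close>, and \<open>x\<close> obeys one
  with factor \<open>\<xi>\<^sub>2\<close> and source \<open>y\<close>. Unlike partial fractions,
  this tolerates a double root. The root bounds are common to all modes, so norms over the modes can
  be taken at every step.\<close>

lemma BDF2_modes_stability:
  fixes x r :: "nat \<Rightarrow> nat \<Rightarrow> real" and z :: "nat \<Rightarrow> real"
  assumes z0: "0 < z0" "z0 < 1/4" and z: "\<And>k. z0 \<le> z k"
    and init: "\<And>k. x 0 k = 0" "\<And>k. (1 + z k) * x 1 k = r 1 k"
    and step: "\<And>k n. 2 \<le> n \<Longrightarrow> n \<le> N \<Longrightarrow>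
        (3/2 + z k) * x n k = 2 * x (n - 1) k - 1/2 * x (n - 2) k + r n k"
    and \<rho>: "\<And>n. 1 \<le> n \<Longrightarrow> n \<le> N \<Longrightarrow> L2_set (r n) K \<le> \<rho> n"
    and n: "n \<le> N"
  shows "L2_set (x n) K \<le> 8/3 * (\<Sum>j=1..n. exp (- (3/4 * z0)) ^ (n - j) * \<rho> j)"
proof -
  define q where "q = exp (- (3/4 * z0))"
  have q: "4/5 \<le> q" "0 < q"
    using exp_ge_add_one_self[of "- (3/4 * z0)"] z0 by (auto simp: q_def)
  have "\<forall>k. \<exists>\<xi>\<^sub>1 \<xi>\<^sub>2 :: complex. (3/2 + of_real (z k)) * (\<xi>\<^sub>1 + \<xi>\<^sub>2) = 2 \<and>
      (3/2 + of_real (z k)) * (\<xi>\<^sub>1 * \<xi>\<^sub>2) = 1/2 \<and> cmod \<xi>\<^sub>1 \<le> q \<and> cmod \<xi>\<^sub>2 \<le> 1/2"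
    using BDF2_characteristic_roots[OF z0 z] unfolding q_def by metis
  then obtain \<xi>\<^sub>1 \<xi>\<^sub>2 :: "nat \<Rightarrow> complex" where
    root_sum: "\<And>k. (3/2 + of_real (z k)) * (\<xi>\<^sub>1 k + \<xi>\<^sub>2 k) = 2" and
    root_prod: "\<And>k. (3/2 + of_real (z k)) * (\<xi>\<^sub>1 k * \<xi>\<^sub>2 k) = 1/2" and
    root_le: "\<And>k. cmod (\<xi>\<^sub>1 k) \<le> q" "\<And>k. cmod (\<xi>\<^sub>2 k) \<le> 1/2"
    by metis
  define y where "y = (\<lambda>n k. complex_of_real (x n k) - \<xi>\<^sub>2 k * of_real (x (n - 1) k))"
  define S where "S = (\<lambda>n. \<Sum>j=1..n. q ^ (n - j) * \<rho> j)"
  have S_Suc: "S (Suc n) = q * S n + \<rho> (Suc n)" for n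
    by (auto simp: S_def sum_distrib_left Suc_diff_le intro!: sum.cong)
  have \<rho>_nonneg: "0 \<le> \<rho> n" if "1 \<le> n" "n \<le> N" for n
    using \<rho>[OF that] L2_set_nonneg order_trans by blast
  have S_nonneg: "0 \<le> S n" if "n \<le> N" for n
    unfolding S_def using q \<rho>_nonneg that by (intro sum_nonneg mult_nonneg_nonneg) auto
  have y_step: "cmod (y (Suc n) k) \<le> q * cmod (y n k) + \<bar>r (Suc n) k\<bar>" if "1 \<le> n" "Suc n \<le> N" for n k
  proof -
    have "(3/2 + of_real (z k)) * of_real (x (Suc n) k)
        = 2 * complex_of_real (x n k) - 1/2 * of_real (x (n - 1) k) + of_real (r (Suc n) k)"
      using step[of "Suc n" k, THEN arg_cong[of _ _ complex_of_real]] that by simp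
    \<comment> \<open>Vieta's relations replace the coefficients \<open>2\<close> and
      \<open>1/2\<close>, after which the right side factors through \<open>y n\<close>.\<close>
    then have "(3/2 + of_real (z k)) * y (Suc n) k
        = (3/2 + of_real (z k)) * (\<xi>\<^sub>1 k + \<xi>\<^sub>2 k) * of_real (x n k)
          - (3/2 + of_real (z k)) * (\<xi>\<^sub>1 k * \<xi>\<^sub>2 k) * of_real (x (n - 1) k) + of_real (r (Suc n) k)
          - (3/2 + of_real (z k)) * \<xi>\<^sub>2 k * of_real (x n k)"
      unfolding root_sum root_prod by (simp add: y_def algebra_simps)
    also have "\<dots> = (3/2 + of_real (z k)) * (\<xi>\<^sub>1 k * y n k) + of_real (r (Suc n) k)"
      by (simp add: y_def algebra_simps)
    finally have eq: "(3/2 + of_real (z k)) * (y (Suc n) k - \<xi>\<^sub>1 k * y n k) = of_real (r (Suc n) k)"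
      by (simp add: algebra_simps)
    have pos: "1 \<le> 3/2 + z k" using z0 z[of k] by linarith
    have "cmod (3/2 + of_real (z k)) = 3/2 + z k"
      using pos norm_of_real[of "3/2 + z k", where 'a = complex] by simp
    then have "(3/2 + z k) * cmod (y (Suc n) k - \<xi>\<^sub>1 k * y n k) = \<bar>r (Suc n) k\<bar>"
      using eq[THEN arg_cong[of _ _ cmod]] by (simp add: norm_mult)
    then have "cmod (y (Suc n) k - \<xi>\<^sub>1 k * y n k) \<le> \<bar>r (Suc n) k\<bar>"
      using mult_right_mono[OF pos norm_ge_zero, of "y (Suc n) k - \<xi>\<^sub>1 k * y n k"] by simp
    moreover have "cmod (\<xi>\<^sub>1 k * y n k) \<le> q * cmod (y n k)"
      by (simp add: norm_mult root_le mult_right_mono)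
    ultimately show ?thesis
      using norm_triangle_ineq[of "y (Suc n) k - \<xi>\<^sub>1 k * y n k" "\<xi>\<^sub>1 k * y n k"] by simp
  qed
  have L2_step: "L2_set f K \<le> c * L2_set g K + L2_set h K"
    if "\<And>k. 0 \<le> f k" "\<And>k. f k \<le> c * g k + h k" "0 \<le> c" for f g h :: "nat \<Rightarrow> real" and c
  proof -
    have "L2_set f K \<le> L2_set (\<lambda>k. c * g k + h k) K"
      using that by (intro L2_set_mono) auto
    also have "\<dots> \<le> L2_set (\<lambda>k. c * g k) K + L2_set h K"
      by (rule L2_set_triangle_ineq)
    finally show ?thesis using that by (simp add: L2_set_right_distrib)
  qed
  have L2_abs: "L2_set (\<lambda>k. \<bar>f k\<bar>) K = L2_set f K" for f
    by (simp add: L2_set_def)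
  have x1: "\<bar>x 1 k\<bar> \<le> \<bar>r 1 k\<bar>" for k
  proof -
    have "1 * \<bar>x 1 k\<bar> \<le> (1 + z k) * \<bar>x 1 k\<bar>"
      using z0 z[of k] by (intro mult_right_mono) auto
    also have "\<dots> = \<bar>r 1 k\<bar>" using z0 z[of k] by (simp add: init(2)[symmetric] abs_mult del: One_nat_def)
    finally show ?thesis by simp
  qed
  have Y: "n \<le> N \<Longrightarrow> L2_set (\<lambda>k. cmod (y n k)) K \<le> S n" for n
  proof (induction n)
    case 0
    \<comment> \<open>Truncated subtraction reads \<open>x (0 - 1)\<close> as \<open>x 0\<close>, so
      \<open>y 0\<close> vanishes with \<open>x 0\<close>.\<close>
    then show ?case by (simp add: y_def init S_def L2_set_def)
  next
    case (Suc n)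
    have "L2_set (\<lambda>k. cmod (y (Suc n) k)) K
        \<le> q * L2_set (\<lambda>k. cmod (y n k)) K + L2_set (\<lambda>k. \<bar>r (Suc n) k\<bar>) K"
    proof (rule L2_step)
      fix k show "cmod (y (Suc n) k) \<le> q * cmod (y n k) + \<bar>r (Suc n) k\<bar>"
      \<comment> \<open>The first step is backward Euler and does not follow the recursion; since
        \<open>x 0 = 0\<close>, it reduces to \<open>y 1 = x 1\<close>.\<close>
      proof (cases "n = 0")
        case True
        then show ?thesis using x1[of k] by (simp add: y_def init(1))
      qed (use y_step Suc.prems in auto)
    qed (use q in auto)
    also have "\<dots> \<le> q * S n + \<rho> (Suc n)"
      using Suc q \<rho>[of "Suc n"] by (intro add_mono mult_left_mono) (auto simp: L2_abs)
    finally show ?case by (simp add: S_Suc)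
  qed
  have "n \<le> N \<Longrightarrow> L2_set (\<lambda>k. \<bar>x n k\<bar>) K \<le> 8/3 * S n" for n
  proof (induction n)
    case 0
    then show ?case by (simp add: init S_def L2_set_def)
  next
    case (Suc n)
    have "L2_set (\<lambda>k. \<bar>x (Suc n) k\<bar>) K \<le> 1/2 * L2_set (\<lambda>k. \<bar>x n k\<bar>) K + L2_set (\<lambda>k. cmod (y (Suc n) k)) K"
    proof (rule L2_step)
      fix k
      have "cmod (\<xi>\<^sub>2 k * of_real (x n k)) \<le> 1/2 * \<bar>x n k\<bar>"
        using mult_right_mono[OF root_le(2) abs_ge_zero] by (simp add: norm_mult)
      then show "\<bar>x (Suc n) k\<bar> \<le> 1/2 * \<bar>x n k\<bar> + cmod (y (Suc n) k)"
        using norm_triangle_ineq[of "\<xi>\<^sub>2 k * of_real (x n k)" "y (Suc n) k"] by (simp add: y_def)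
    qed auto
    also have "\<dots> \<le> 1/2 * (8/3 * S n) + S (Suc n)"
      using Suc Y by (intro add_mono mult_left_mono) auto
    \<comment> \<open>From \<open>q \<ge> 4/5\<close> one has
      \<open>S n \<le> 5/4 * S (Suc n)\<close>, and \<open>8/3\<close> solves
      \<open>c / 2 * (5/4) + 1 = c\<close>, so the constant reproduces itself.\<close>
    also have "\<dots> \<le> 8/3 * S (Suc n)"
    proof -
      have "4/5 * S n \<le> q * S n"
        using q S_nonneg[of n] Suc.prems by (intro mult_right_mono) auto
      then show ?thesis
        using \<rho>_nonneg[of "Suc n"] Suc.prems by (simp add: S_Suc)
    qed
    finally show ?case .
  qed
  from this[OF n] show ?thesis by (simp add: L2_abs S_def q_def)
qed

section \<open>Weighted sums and the singularity at the initial time\<close>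

text \<open>The induction carries the sharper bound \<open>2 - 1 / real n\<close>, which telescopes
  from \<open>n = 1\<close> on; at \<open>n = 0\<close> it reads \<open>2\<close>, because division
  by zero gives zero.\<close>

lemma sum_inverse_squares_le: "(\<Sum>j=1..n. 1 / (real j)\<^sup>2) \<le> 2"
proof -
  have "(\<Sum>j=1..n. 1 / (real j)\<^sup>2) \<le> 2 - 1 / real n"
  proof (induction n)
    case (Suc n)
    have "1 / (real (Suc n))\<^sup>2 \<le> 1 / real n - 1 / real (Suc n)" if "0 < n"
      using that by (simp add: divide_simps power2_eq_square)
    then show ?case using Suc by (cases "n = 0") auto
  qed simp
  then show ?thesis by (smt (verit) divide_nonneg_nonneg of_nat_0_le_iff)
qed

lemma third_powr_le:
  fixes \<alpha> :: real
  assumes "0 \<le> \<alpha>" "\<alpha> \<le> 1"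
  shows "(real n / 3) powr (\<alpha> - 3) \<le> 27 * real n powr (\<alpha> - 3)"
proof -
  have "(real n / 3) powr (\<alpha> - 3) = 3 powr (3 - \<alpha>) * real n powr (\<alpha> - 3)"
  proof -
    have "3 powr (\<alpha> - 3) = 1 / 3 powr (3 - \<alpha>)"
      using powr_minus_divide[of 3 "3 - \<alpha>"] by simp
    then show ?thesis by (simp add: powr_divide)
  qed
  also have "\<dots> \<le> 3 powr 3 * real n powr (\<alpha> - 3)"
    using assms by (intro mult_right_mono powr_mono) auto
  finally show ?thesis by simp
qed

text \<open>For \<open>3 * j \<le> n\<close> at least two thirds of the steps remain, which turns
  the rate \<open>3/4\<close> into \<open>1/2\<close>, and the power is at most an inverse square.
  For later \<open>j\<close> the decay is dropped, and at most \<open>n\<close> terms of order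
  \<open>n powr (\<alpha> - 3)\<close> add up.\<close>

lemma weighted_power_sum_le:
  fixes \<alpha> z :: real
  assumes "0 \<le> \<alpha>" "\<alpha> \<le> 1" and z: "0 \<le> z" and n: "1 \<le> n"
  shows "(\<Sum>j=1..n. exp (- (3/4 * z)) ^ (n - j) * real j powr (\<alpha> - 3))
      \<le> 2 * exp (- (real n * z / 2)) + 27 * real n powr (\<alpha> - 2)"
proof -
  \<comment> \<open>Each term is bounded by the sum of the bounds for early and late
    \<open>j\<close>, so the sum itself is never split.\<close>
  have "exp (- (3/4 * z)) ^ (n - j) * real j powr (\<alpha> - 3)
      \<le> exp (- (real n * z / 2)) * (1 / (real j)\<^sup>2) + 27 * real n powr (\<alpha> - 3)"
    if j: "1 \<le> j" "j \<le> n" for j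
  proof (cases "3 * j \<le> n")
    case True
    have "real n \<le> 3/2 * real (n - j)"
      using True j by (simp add: of_nat_diff)
    then have "real n * z \<le> 3/2 * real (n - j) * z"
      using z by (rule mult_right_mono)
    then have "exp (- (3/4 * z)) ^ (n - j) \<le> exp (- (real n * z / 2))"
      by (simp add: exp_of_nat_mult[symmetric] mult.commute[of z])
    moreover have "real j powr (\<alpha> - 3) \<le> real j powr (- 2)"
      using assms j by (intro powr_mono) auto
    moreover have "real j powr (- 2) = 1 / (real j)\<^sup>2"
      using j by (simp add: powr_minus_divide)
    ultimately have "exp (- (3/4 * z)) ^ (n - j) * real j powr (\<alpha> - 3)
        \<le> exp (- (real n * z / 2)) * (1 / (real j)\<^sup>2)"
      by (intro mult_mono) auto
    moreover have "0 \<le> 27 * real n powr (\<alpha> - 3)" by simp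
    ultimately show ?thesis by linarith
  next
    case False
    have "real j powr (\<alpha> - 3) \<le> (real n / 3) powr (\<alpha> - 3)"
      using False assms j by (intro powr_mono2') auto
    also have "\<dots> \<le> 27 * real n powr (\<alpha> - 3)"
      using assms by (intro third_powr_le) auto
    finally have le: "real j powr (\<alpha> - 3) \<le> 27 * real n powr (\<alpha> - 3)" .
    have "exp (- (3/4 * z)) ^ (n - j) * real j powr (\<alpha> - 3) \<le> 1 * real j powr (\<alpha> - 3)"
      using z by (intro mult_right_mono power_le_one) auto
    moreover have "0 \<le> exp (- (real n * z / 2)) * (1 / (real j)\<^sup>2)"
      by simp
    ultimately show ?thesis using le by linarith
  qed
  then have "(\<Sum>j=1..n. exp (- (3/4 * z)) ^ (n - j) * real j powr (\<alpha> - 3))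
      \<le> (\<Sum>j=1..n. exp (- (real n * z / 2)) * (1 / (real j)\<^sup>2) + 27 * real n powr (\<alpha> - 3))"
    by (intro sum_mono) auto
  also have "\<dots> = exp (- (real n * z / 2)) * (\<Sum>j=1..n. 1 / (real j)\<^sup>2) + 27 * (real n * real n powr (\<alpha> - 3))"
    by (simp add: sum.distrib sum_distrib_left)
  also have "\<dots> \<le> exp (- (real n * z / 2)) * 2 + 27 * (real n * real n powr (\<alpha> - 3))"
    by (intro add_right_mono mult_left_mono sum_inverse_squares_le) simp
  also have "real n * real n powr (\<alpha> - 3) = real n powr (\<alpha> - 2)"
    using n powr_mult_base[of "real n" "\<alpha> - 3"] by simp
  finally show ?thesis by simp
qed

text \<open>From \<open>n = 3\<close> on the stencil stays away from time zero and the bound on the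
  third derivative applies. For the first two steps it reaches the singularity, where only the bound
  on the first derivative is integrable; its integral brings in \<open>1 / \<alpha>\<close>.\<close>

lemma BDF2_truncation:
  fixes g :: "nat \<Rightarrow> real \<Rightarrow> real"
  assumes \<alpha>: "0 < \<alpha>" "\<alpha> < 1" and h: "0 < h" and B: "0 \<le> B"
    and cont: "continuous_on {0..T} (g 0)"
    and deriv: "\<And>k t. k < 3 \<Longrightarrow> t \<in> {0<..T} \<Longrightarrow>
        (g k has_real_derivative g (Suc k) t) (at t within {0<..T})"
    and bound: "\<And>k t. k \<in> {1, 2, 3} \<Longrightarrow> t \<in> {0<..T} \<Longrightarrow> \<bar>g k t\<bar> \<le> B * t powr (\<alpha> - real k)"
  shows "h \<le> T \<Longrightarrow> \<bar>g 0 h - g 0 0 - h * g 1 h\<bar> \<le> (16 / \<alpha> + 9) * B * h powr \<alpha>" (is "_ \<Longrightarrow> ?T1")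
    and "2 \<le> n \<Longrightarrow> real n * h \<le> T \<Longrightarrow>
      \<bar>3/2 * g 0 (real n * h) - 2 * g 0 (real (n - 1) * h) + 1/2 * g 0 (real (n - 2) * h)
         - h * g 1 (real n * h)\<bar>
      \<le> (16 / \<alpha> + 9) * B * h powr \<alpha> * real n powr (\<alpha> - 3)" (is "_ \<Longrightarrow> _ \<Longrightarrow> ?T2")
proof -
  have deriv_at: "(g k has_real_derivative g (Suc k) t) (at t)" if "k < 3" "0 < t" "t < T" for k t
  proof -
    have "at t within {0<..T} = at t"
      using that by (intro at_within_open_subset[of t "{0<..<T}"]) auto
    then show ?thesis
      using deriv[of k t] that by simp
  qed
  have increment: "\<bar>g 0 b - g 0 a\<bar> \<le> B / \<alpha> * b powr \<alpha> - B / \<alpha> * a powr \<alpha>"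
    if "0 \<le> a" "a \<le> b" "b \<le> T" for a b
  proof (rule increment_le_of_deriv_le[where G = "\<lambda>t. B / \<alpha> * t powr \<alpha>"
        and f' = "g 1" and G' = "\<lambda>t. B * t powr (\<alpha> - 1)"])
    show "continuous_on {a..b} (g 0)"
      using that by (intro continuous_on_subset[OF cont]) auto
    show "continuous_on {a..b} (\<lambda>t. B / \<alpha> * t powr \<alpha>)"
      using that \<alpha> by (intro continuous_intros continuous_on_powr') auto
    fix t assume t: "a < t" "t < b"
    show "(g 0 has_real_derivative g 1 t) (at t)"
      using deriv_at[of 0 t] t that by simp
    show "((\<lambda>t. B / \<alpha> * t powr \<alpha>) has_real_derivative B * t powr (\<alpha> - 1)) (at t)"
      using t that \<alpha> by (auto intro!: derivative_eq_intros simp: field_simps)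
    show "\<bar>g 1 t\<bar> \<le> B * t powr (\<alpha> - 1)"
      using bound[of 1 t] t that by simp
  qed fact
  have slope: "\<bar>h * g 1 t\<bar> \<le> B * h powr \<alpha>" if "h \<le> t" "t \<le> T" for t
  proof -
    have "\<bar>g 1 t\<bar> \<le> B * t powr (\<alpha> - 1)"
      using bound[of 1 t] that h by simp
    also have "\<dots> \<le> B * h powr (\<alpha> - 1)"
      using that h \<alpha> B by (intro mult_left_mono powr_mono2') auto
    finally have "\<bar>h * g 1 t\<bar> \<le> h * (B * h powr (\<alpha> - 1))"
      using h by (simp add: abs_mult)
    also have "\<dots> = B * h powr \<alpha>"
      using h powr_mult_base[of h "\<alpha> - 1"] by (simp add: mult.left_commute)
    finally show ?thesis .
  qed
  define E where "E = B * h powr \<alpha>"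
  have E: "0 \<le> E" "0 \<le> E / \<alpha>" using B \<alpha> by (auto simp: E_def)
  show ?T1 if "h \<le> T"
    using increment[of 0 h] slope[of h] that h E by (simp add: E_def algebra_simps abs_le_iff)
  show ?T2 if n: "2 \<le> n" and nT: "real n * h \<le> T"
  proof (cases "n = 2")
    case True
    \<comment> \<open>At \<open>n = 2\<close> the required power of \<open>n\<close> is at least
      \<open>1/8\<close>; inserting it costs a factor eight, which turns \<open>2 / \<alpha>\<close>
      into \<open>16 / \<alpha>\<close>.\<close>
    have "2 powr (\<alpha> - 3) \<ge> 2 powr (- 3 :: real)"
      using \<alpha> by (intro powr_mono) auto
    then have pow: "1/8 \<le> 2 powr (\<alpha> - 3)"
      by (simp add: powr_minus_divide)
    have "2 powr \<alpha> \<le> 2 powr (1::real)"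
      using \<alpha> by (intro powr_mono) auto
    then have "E / \<alpha> * 2 powr \<alpha> \<le> E / \<alpha> * 2"
      using E by (intro mult_left_mono) auto
    moreover have "B / \<alpha> * (2 * h) powr \<alpha> = E / \<alpha> * 2 powr \<alpha>"
      using h by (simp add: powr_mult E_def)
    moreover have "B / \<alpha> * h powr \<alpha> = E / \<alpha>" by (simp add: E_def)
    ultimately have "\<bar>g 0 (2 * h) - g 0 h\<bar> \<le> E / \<alpha>" "\<bar>g 0 h - g 0 0\<bar> \<le> E / \<alpha>"
      using increment[of h "2 * h"] increment[of 0 h] nT True h by auto
    moreover have "\<bar>h * g 1 (2 * h)\<bar> \<le> E"
      using slope[of "2 * h"] nT True h by (simp add: E_def)
    \<comment> \<open>The stencil is \<open>3/2\<close> times the second increment minus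
      \<open>1/2\<close> times the first, whence \<open>2 * (E / \<alpha>)\<close>.\<close>
    ultimately have "\<bar>3/2 * g 0 (2 * h) - 2 * g 0 h + 1/2 * g 0 0 - h * g 1 (2 * h)\<bar> \<le> 2 * (E / \<alpha>) + E"
      by (simp only: abs_le_iff) linarith
    also have "\<dots> \<le> (16 * (E / \<alpha>) + 9 * E) * (1/8)"
      using E by simp
    also have "\<dots> \<le> (16 * (E / \<alpha>) + 9 * E) * 2 powr (\<alpha> - 3)"
      using E pow by (intro mult_left_mono) auto
    finally show ?thesis
      using True by (simp add: E_def algebra_simps)
  next
    case False
    define a where "a = real (n - 2) * h"
    have a: "real n * h - 2 * h = a" "real n * h - h = real (n - 1) * h"
      using n by (auto simp: a_def of_nat_diff algebra_simps)
    have a_pos: "0 < a" using n False h by (simp add: a_def)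
    have cont_k: "continuous_on {real n * h - 2 * h..real n * h} (g k)" if "k < 3" for k
      using a_pos nT a
      by (intro continuous_on_subset[OF DERIV_continuous_on[OF deriv[OF that]]]) auto
    have "\<bar>3/2 * g 0 (real n * h) - 2 * g 0 (real n * h - h) + 1/2 * g 0 (real n * h - 2 * h)
         - h * g 1 (real n * h)\<bar> \<le> (B * a powr (\<alpha> - 3)) * h ^ 3 / 3"
    proof (rule BDF2_truncation_smooth[OF h])
      fix t assume "real n * h - 2 * h < t" "t < real n * h"
      then have t: "a < t" "0 < t" "t < T" using a a_pos nT by auto
      show "(g 0 has_real_derivative g 1 t) (at t)" "(g 1 has_real_derivative g 2 t) (at t)"
        "(g 2 has_real_derivative g 3 t) (at t)"
        using deriv_at[of 0 t] deriv_at[of 1 t] deriv_at[of 2 t] t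
        by (simp_all add: numeral_2_eq_2 numeral_3_eq_3)
      have "\<bar>g 3 t\<bar> \<le> B * t powr (\<alpha> - 3)"
        using bound[of 3 t] t by simp
      also have "\<dots> \<le> B * a powr (\<alpha> - 3)"
        using t a_pos \<alpha> B by (intro mult_left_mono powr_mono2') auto
      finally show "\<bar>g 3 t\<bar> \<le> B * a powr (\<alpha> - 3)" .
    qed (use cont_k in auto)
    also have "\<dots> \<le> (9 * B * h powr \<alpha>) * real n powr (\<alpha> - 3)"
    proof -
      \<comment> \<open>\<open>n - 2 \<ge> n / 3\<close> holds from \<open>n = 3\<close> on. The
        resulting factor \<open>27\<close>, divided by the \<open>3\<close> of the Taylor bound, is
        the \<open>9\<close> in the constant.\<close>
      have "real n / 3 * h \<le> a"
        unfolding a_def using n False h by (intro mult_right_mono) (auto simp: of_nat_diff)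
      then have "a powr (\<alpha> - 3) \<le> (real n / 3 * h) powr (\<alpha> - 3)"
        using \<alpha> n h by (intro powr_mono2') auto
      also have "\<dots> = (real n / 3) powr (\<alpha> - 3) * h powr (\<alpha> - 3)"
        using h powr_mult[of "real n / 3" h] by simp
      also have "\<dots> \<le> (27 * real n powr (\<alpha> - 3)) * h powr (\<alpha> - 3)"
        using third_powr_le[of \<alpha> n] \<alpha> by (intro mult_right_mono) auto
      finally have "B * a powr (\<alpha> - 3) * h ^ 3 / 3
          \<le> B * (27 * real n powr (\<alpha> - 3) * h powr (\<alpha> - 3)) * h ^ 3 / 3"
        using B h by (intro divide_right_mono mult_right_mono mult_left_mono) auto
      also have "\<dots> = 9 * B * (h powr (\<alpha> - 3) * h powr 3) * real n powr (\<alpha> - 3)"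
        using h by (simp add: powr_numeral)
      also have "h powr (\<alpha> - 3) * h powr 3 = h powr \<alpha>"
        by (simp add: powr_add[symmetric])
      finally show ?thesis .
    qed
    also have "\<dots> \<le> (16 / \<alpha> + 9) * B * h powr \<alpha> * real n powr (\<alpha> - 3)"
      using \<alpha> B by (intro mult_right_mono) auto
    finally show ?thesis by (simp only: a a_def)
  qed
qed

section \<open>Comparison with the constants of the estimate\<close>

text \<open>The second term \<open>P\<close> has to be absorbed even where \<open>C12\<close>
  vanishes. If \<open>E \<le> 1/4\<close>, then \<open>C12\<close> is at least \<open>1/4\<close>;
  otherwise \<open>\<tau> \<le> t\<close> bounds \<open>P\<close> by
  \<open>\<tau> powr \<alpha>\<close>, which is at most four times the first term \<open>A\<close>.
  Hence \<open>P_le\<close>, and \<open>110 = 2 + 27 * 4\<close>.\<close>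

lemma C11_C12_dominates:
  assumes "0 < \<alpha>" "\<alpha> < 1" "\<kappa> < lam1" "0 < \<tau>" "\<tau> \<le> t"
  shows "2 * (exp (- (lam1 - \<kappa>) * t / 2) * \<tau> powr \<alpha>) + 27 * (t powr (\<alpha> - 2) * \<tau>\<^sup>2)
      \<le> 110 * (C11 \<alpha> lam1 \<kappa> t * exp (- (lam1 - \<kappa>) * t / 2) * \<tau> powr \<alpha>
               + C12 \<alpha> lam1 \<kappa> t * t powr (\<alpha> - 2) * \<tau>\<^sup>2)"
proof -
  define \<nu> where "\<nu> = lam1 - \<kappa>"
  define E where "E = exp (- \<nu> * t / 2)"
  have \<nu>: "0 < \<nu>" using assms by (simp add: \<nu>_def)
  have C11: "1 \<le> C11 \<alpha> lam1 \<kappa> t"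
  proof -
    have "1 \<le> 2 / (2 - \<alpha>)" using assms by simp
    then show ?thesis by (simp add: C11_def add_increasing2)
  qed
  have p: "2 powr (\<alpha> - 2) < 1/2"
  proof -
    have "2 powr (\<alpha> - 2) < 2 powr (- 1 :: real)" using assms by (intro powr_less_mono) auto
    then show ?thesis by (simp add: powr_minus_divide)
  qed
  have p': "2 \<le> 2 powr (2 - \<alpha>)"
    using powr_mono[of 1 "2 - \<alpha>" 2] assms by simp
  \<comment> \<open>The case condition says that the bracket in \<open>C12\<close> is positive, so
    \<open>C12\<close> is a positive part and thus nonnegative.\<close>
  have threshold: "t > - (2 / (lam1 - \<kappa>)) * ln (1 - 2 powr (\<alpha> - 2)) \<longleftrightarrow> E < 1 - 2 powr (\<alpha> - 2)"
  proof -
    have "t > - (2 / \<nu>) * ln (1 - 2 powr (\<alpha> - 2)) \<longleftrightarrow> - \<nu> * t / 2 < ln (1 - 2 powr (\<alpha> - 2))"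
      using \<nu> by (auto simp: field_simps)
    also have "\<dots> \<longleftrightarrow> E < 1 - 2 powr (\<alpha> - 2)"
      using p exp_less_cancel_iff[of "- \<nu> * t / 2" "ln (1 - 2 powr (\<alpha> - 2))"] by (simp add: E_def)
    finally show ?thesis by (simp add: \<nu>_def)
  qed
  have C12_eq: "C12 \<alpha> lam1 \<kappa> t = (if E < 1 - 2 powr (\<alpha> - 2) then 1 / (2 - \<alpha>) * (2 powr (2 - \<alpha>) * (1 - E) - 1) else 0)"
    unfolding C12_def threshold by (simp add: E_def \<nu>_def)
  have C12_nonneg: "0 \<le> C12 \<alpha> lam1 \<kappa> t"
  proof (cases "E < 1 - 2 powr (\<alpha> - 2)")
    case True
    have "1 = 2 powr (2 - \<alpha>) * 2 powr (\<alpha> - 2)"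
      by (simp add: powr_add[symmetric])
    also have "\<dots> \<le> 2 powr (2 - \<alpha>) * (1 - E)"
      using True by (intro mult_left_mono) auto
    finally show ?thesis using True assms by (simp add: C12_eq)
  qed (simp add: C12_eq)
  define A where "A = E * \<tau> powr \<alpha>"
  define P where "P = t powr (\<alpha> - 2) * \<tau>\<^sup>2"
  have AP: "0 \<le> A" "0 \<le> P" by (auto simp: A_def P_def E_def)
  have P_le: "P \<le> 4 * A + 4 * (C12 \<alpha> lam1 \<kappa> t * P)"
  proof (cases "E \<le> 1/4")
    case True
    have "2 * (3/4) \<le> 2 powr (2 - \<alpha>) * (1 - E)"
      using p' True by (intro mult_mono) auto
    then have "1/2 * (1/2) \<le> 1 / (2 - \<alpha>) * (2 powr (2 - \<alpha>) * (1 - E) - 1)"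
      using assms by (intro mult_mono) (auto simp: field_simps)
    then have "1/4 \<le> C12 \<alpha> lam1 \<kappa> t"
      using True p by (simp add: C12_eq)
    from mult_right_mono[OF this AP(2)] show ?thesis using AP by simp
  next
    case False
    have "t powr (\<alpha> - 2) \<le> \<tau> powr (\<alpha> - 2)"
      using assms by (intro powr_mono2') auto
    then have "P \<le> \<tau> powr (\<alpha> - 2) * \<tau> powr 2"
      using assms by (simp add: P_def mult_right_mono)
    also have "\<dots> = \<tau> powr \<alpha>" by (simp add: powr_add[symmetric])
    also have "\<dots> = 4 * (1/4 * \<tau> powr \<alpha>)" by simp
    also have "\<dots> \<le> 4 * A"
      using False unfolding A_def by (intro mult_left_mono mult_right_mono) auto
    finally show ?thesis using C12_nonneg AP by (simp add: add_increasing2)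
  qed
  have "A \<le> C11 \<alpha> lam1 \<kappa> t * A"
    using mult_right_mono[OF C11 AP(1)] by simp
  moreover have "0 \<le> C12 \<alpha> lam1 \<kappa> t * P"
    using C12_nonneg AP by simp
  ultimately have "2 * A + 27 * P \<le> 110 * (C11 \<alpha> lam1 \<kappa> t * A + C12 \<alpha> lam1 \<kappa> t * P)"
    using P_le unfolding distrib_left by linarith
  then show ?thesis
    by (simp add: A_def P_def E_def \<nu>_def mult.assoc)
qed

section \<open>The error estimate\<close>

lemma BDF2_error_bound:
  fixes \<alpha> M lam1 \<kappa> T \<tau> :: real
  assumes \<alpha>: "0 < \<alpha>" "\<alpha> < 1"
    and dom: "bounded_domain d \<Omega>"
    and basis: "dirichlet_eigenbasis d \<Omega> lam \<omega>"
    and minimal: "minimal_dirichlet_eigenvalue d \<Omega> lam1"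
    and \<kappa>: "\<kappa> < lam1"
    and T: "0 < T" and N: "2 \<le> N" and \<tau>: "\<tau> = T / real N"
    and sol: "parabolic_solution d \<Omega> T \<kappa> f u0 u D"
    and bound: "\<And>k t. k \<in> {1, 2, 3} \<Longrightarrow> t \<in> {0<..T} \<Longrightarrow>
        L2_norm (leb_on d \<Omega>) (D k t) \<le> M * t powr (\<alpha> - real k)"
    and scheme: "bdf2_scheme d \<Omega> \<kappa> f u0 \<tau> N U"
    and small: "\<tau> < 1 / (4 * (lam1 - \<kappa>))"
    and n: "1 \<le> n" "n \<le> N"
  shows "L2_norm (leb_on d \<Omega>) (\<lambda>x. u (real n * \<tau>) x - U n x)
    \<le> 8/3 * ((16 / \<alpha> + 9) * (\<bar>M\<bar> + 1)) *
        (2 * (exp (- (lam1 - \<kappa>) * (real n * \<tau>) / 2) * \<tau> powr \<alpha>)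
         + 27 * ((real n * \<tau>) powr (\<alpha> - 2) * \<tau>\<^sup>2))"
proof -
  let ?Q = "leb_on d \<Omega>"
  define z0 where "z0 = \<tau> * (lam1 - \<kappa>)"
  define z where "z = (\<lambda>k. \<tau> * (lam k - \<kappa>))"
  \<comment> \<open>This majorizes \<open>M\<close> and is positive whatever the sign of
    \<open>M\<close>.\<close>
  define M' where "M' = \<bar>M\<bar> + 1"
  define K where "K = (16 / \<alpha> + 9) * M' * \<tau> powr \<alpha>"
  have \<tau>_pos: "0 < \<tau>" using T N \<tau> by simp
  have z0: "0 < z0" "z0 < 1/4"
    using \<tau>_pos \<kappa> small by (auto simp: z0_def field_simps)
  have time: "real j * \<tau> \<in> {0..T}" if "j \<le> N" for j
  proof -
    have "real j * \<tau> \<le> real N * \<tau>" using that \<tau>_pos by simp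
    moreover have "real N * \<tau> = T" using N by (simp add: \<tau>)
    ultimately show ?thesis using \<tau>_pos by simp
  qed
  have time_pos: "real j * \<tau> \<in> {0<..T}" if "1 \<le> j" "j \<le> N" for j
    using time[OF that(2)] that \<tau>_pos by simp

  have eigen: "dirichlet_eigenfunction d \<Omega> (lam k) (\<omega> k)" for k
    using basis by (simp add: dirichlet_eigenbasis_def)
  have \<omega>: "\<omega> k \<in> L2 ?Q" for k
    using eigen by (rule dirichlet_eigenfunction_L2)
  have orth: "L2_inner ?Q (\<omega> j) (\<omega> k) = (if j = k then 1 else 0)" for j k
    using basis by (simp add: dirichlet_eigenbasis_def)
  \<comment> \<open>Minimality is applied to every eigenvalue of the basis, which bounds all modes
    below at once.\<close>
  have z_ge: "z0 \<le> z k" for k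
  proof -
    have "lam1 \<le> lam k"
      using minimal eigen by (auto simp: minimal_dirichlet_eigenvalue_def)
    then show ?thesis using \<tau>_pos by (simp add: z0_def z_def)
  qed

  have D0: "D 0 = u" and D_cont: "\<And>k. k \<le> 3 \<Longrightarrow> L2_continuous_on ?Q {0<..T} (D k)"
    and D_deriv: "\<And>k. k < 3 \<Longrightarrow> L2_has_derivative_on ?Q {0<..T} (D k) (D (Suc k))"
    and u_cont: "L2_continuous_on ?Q {0..T} u"
    and u_init: "AE x in ?Q. u 0 x = u0 x"
    using sol by (auto simp: parabolic_solution_def L2_derivatives_on_def)
  have u_L2: "u t \<in> L2 ?Q" if "t \<in> {0..T}" for t
    using u_cont that by (auto simp: L2_continuous_on_def)
  have D_L2: "D k t \<in> L2 ?Q" if "k \<le> 3" "t \<in> {0<..T}" for k t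
    using D_cont[OF that(1)] that(2) by (auto simp: L2_continuous_on_def)
  have U_L2: "U j \<in> L2 ?Q" if "1 \<le> j" "j \<le> N" for j
  proof (cases "j = 1")
    case True
    then show ?thesis using scheme by (auto simp: bdf2_scheme_def dest: dirichlet_laplacian_L2)
  next
    case False
    then have "2 \<le> j \<and> j \<le> N" using that by auto
    then show ?thesis using scheme unfolding bdf2_scheme_def by (blast dest: dirichlet_laplacian_L2)
  qed
  have U_init: "AE x in ?Q. U 0 x = u 0 x"
  proof -
    have "AE x in ?Q. U 0 x = u0 x" using scheme by (simp add: bdf2_scheme_def)
    then show ?thesis using u_init by eventually_elim simp
  qed

  \<comment> \<open>Index zero gets the exact zero function in place of a difference that vanishes
    almost everywhere; this makes its coefficients zero, and the step equations hold only almost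
    everywhere in any case.\<close>
  define e where "e = (\<lambda>j x. if j = 0 then 0 else u (real j * \<tau>) x - U j x)"
  \<comment> \<open>The defect of the exact solution in the scheme, scaled by \<open>\<tau>\<close>
    and with \<open>D 1\<close> as the time derivative; \<open>j = 1\<close> is the backward Euler
    step.\<close>
  define \<rho> where "\<rho> = (\<lambda>j x. if j = 1 then u \<tau> x - u 0 x - \<tau> * D 1 \<tau> x
      else 3/2 * u (real j * \<tau>) x - 2 * u (real (j - 1) * \<tau>) x + 1/2 * u (real (j - 2) * \<tau>) x
        - \<tau> * D 1 (real j * \<tau>) x)"
  have e_L2: "e j \<in> L2 ?Q" if "j \<le> N" for j
    using that time[OF that] by (cases "j = 0") (auto simp: e_def intro!: L2_intros u_L2 U_L2)
  have \<rho>1: "\<rho> 1 = (\<lambda>x. u \<tau> x - u 0 x - \<tau> * D 1 \<tau> x)"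
    by (simp add: \<rho>_def)
  have \<rho>_ge2: "\<rho> j = (\<lambda>x. 3/2 * u (real j * \<tau>) x - 2 * u (real (j - 1) * \<tau>) x
      + 1/2 * u (real (j - 2) * \<tau>) x - \<tau> * D 1 (real j * \<tau>) x)" if "2 \<le> j" for j
    using that by (auto simp: \<rho>_def)
  have \<tau>_time: "\<tau> \<in> {0..T}" "\<tau> \<in> {0<..T}"
    using time[of 1] time_pos[of 1] N by auto
  have \<rho>1_L2: "\<rho> 1 \<in> L2 ?Q"
    unfolding \<rho>1 using \<tau>_time T by (intro L2_intros u_L2 D_L2) auto
  have \<rho>_ge2_L2: "\<rho> j \<in> L2 ?Q" if "2 \<le> j" "j \<le> N" for j
    unfolding \<rho>_ge2[OF that(1)] using that
    by (intro L2_intros u_L2 D_L2 time time_pos) auto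

  have eigen_diff: "L2_inner ?Q (\<lambda>x. w' x - w x) (\<omega> k) = - lam k * L2_inner ?Q (e j) (\<omega> k)"
    if "1 \<le> j" "dirichlet_laplacian d \<Omega> (u (real j * \<tau>)) w'" "dirichlet_laplacian d \<Omega> (U j) w"
    for j k w w'
  proof -
    have "e j = (\<lambda>x. u (real j * \<tau>) x - U j x)"
      using that(1) by (simp add: e_def)
    then show ?thesis
      using dirichlet_laplacian_eigenfunction[OF dom that(2) eigen[of k]]
        dirichlet_laplacian_eigenfunction[OF dom that(3) eigen[of k]]
        dirichlet_laplacian_L2[OF that(2)] dirichlet_laplacian_L2[OF that(3)] \<omega>
      by (simp add: L2_inner_diff algebra_simps)
  qed
  have sol_at: "\<exists>w'. dirichlet_laplacian d \<Omega> (u (real j * \<tau>)) w' \<and>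
      (AE x in ?Q. D 1 (real j * \<tau>) x - w' x = \<kappa> * u (real j * \<tau>) x + f (real j * \<tau>) x)"
    if "1 \<le> j" "j \<le> N" for j
    using sol time_pos[OF that] unfolding parabolic_solution_def by blast

  have mode1: "(1 + z k) * L2_inner ?Q (e 1) (\<omega> k) = L2_inner ?Q (\<rho> 1) (\<omega> k)" for k
  proof -
    obtain w where w: "dirichlet_laplacian d \<Omega> (U 1) w"
      and w_eq: "AE x in ?Q. U 1 x - U 0 x = \<tau> * w x + \<kappa> * \<tau> * U 1 x + \<tau> * f \<tau> x"
      using scheme unfolding bdf2_scheme_def by blast
    obtain w' where w': "dirichlet_laplacian d \<Omega> (u (real 1 * \<tau>)) w'"
      and w'_eq: "AE x in ?Q. D 1 \<tau> x - w' x = \<kappa> * u \<tau> x + f \<tau> x"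
      using sol_at[of 1] N by auto
    have L2: "e 1 \<in> L2 ?Q" "w \<in> L2 ?Q" "w' \<in> L2 ?Q"
      using e_L2[of 1] N w w' by (auto dest: dirichlet_laplacian_L2)
    \<comment> \<open>Comparing the scheme with \<open>\<tau>\<close> times the equation cancels
      \<open>f\<close>; the Laplacians leave \<open>w' - w\<close>, which is diagonal on the
      eigenfunctions.\<close>
    have "AE x in ?Q. (1 - \<kappa> * \<tau>) * e 1 x - \<tau> * (w' x - w x) = \<rho> 1 x"
      using w_eq w'_eq U_init
    proof eventually_elim
      case (elim x)
      have "\<tau> * D 1 \<tau> x = \<tau> * (w' x + \<kappa> * u \<tau> x + f \<tau> x)"
        using elim(2) by simp
      moreover have e1: "e 1 x = u \<tau> x - U 1 x" by (simp add: e_def)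
      ultimately show ?case using elim(1,3) unfolding \<rho>1 e1 by (simp add: algebra_simps)
    qed
    then have "L2_inner ?Q (\<lambda>x. (1 - \<kappa> * \<tau>) * e 1 x - \<tau> * (w' x - w x)) (\<omega> k) = L2_inner ?Q (\<rho> 1) (\<omega> k)"
      by (intro L2_inner_cong_AE L2_diff L2_scale L2 \<rho>1_L2 \<omega>)
    moreover have "L2_inner ?Q (\<lambda>x. (1 - \<kappa> * \<tau>) * e 1 x - \<tau> * (w' x - w x)) (\<omega> k)
        = (1 - \<kappa> * \<tau>) * L2_inner ?Q (e 1) (\<omega> k) - \<tau> * L2_inner ?Q (\<lambda>x. w' x - w x) (\<omega> k)"
      by (simp only: L2_inner_diff[OF L2_scale[OF L2(1)] L2_scale[OF L2_diff[OF L2(3,2)]] \<omega>]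
          L2_inner_scale)
    ultimately show ?thesis
      using eigen_diff[OF _ w' w, of k] by (simp add: z_def algebra_simps)
  qed
  have mode: "(3/2 + z k) * L2_inner ?Q (e j) (\<omega> k) = 2 * L2_inner ?Q (e (j - 1)) (\<omega> k)
      - 1/2 * L2_inner ?Q (e (j - 2)) (\<omega> k) + L2_inner ?Q (\<rho> j) (\<omega> k)"
    if j: "2 \<le> j" "j \<le> N" for j k
  proof -
    obtain w where w: "dirichlet_laplacian d \<Omega> (U j) w"
      and w_eq: "AE x in ?Q. 3/2 * U j x - 2 * U (j - 1) x + 1/2 * U (j - 2) x
              = \<tau> * w x + \<kappa> * \<tau> * U j x + \<tau> * f (real j * \<tau>) x"
      using scheme j unfolding bdf2_scheme_def by blast
    obtain w' where w': "dirichlet_laplacian d \<Omega> (u (real j * \<tau>)) w'"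
      and w'_eq: "AE x in ?Q. D 1 (real j * \<tau>) x - w' x
              = \<kappa> * u (real j * \<tau>) x + f (real j * \<tau>) x"
      using sol_at[of j] j by auto
    have L2: "e j \<in> L2 ?Q" "e (j - 1) \<in> L2 ?Q" "e (j - 2) \<in> L2 ?Q" "w \<in> L2 ?Q" "w' \<in> L2 ?Q"
      using e_L2 j w w' by (auto dest: dirichlet_laplacian_L2)
    define v where "v = (\<lambda>x. (3/2 - \<kappa> * \<tau>) * e j x - 2 * e (j - 1) x + 1/2 * e (j - 2) x
        - \<tau> * (w' x - w x))"
    have v_L2: "v \<in> L2 ?Q"
      unfolding v_def by (intro L2_add L2_diff L2_scale L2)
    have "AE x in ?Q. v x = \<rho> j x"
      using w_eq w'_eq U_init
    proof eventually_elim
      case (elim x)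
      \<comment> \<open>At \<open>j = 2\<close> the error with index zero enters, and
        \<open>U_init\<close> reconciles its definition as zero with the general formula.\<close>
      have e: "e j x = u (real j * \<tau>) x - U j x" "e (j - 1) x = u (real (j - 1) * \<tau>) x - U (j - 1) x"
        "e (j - 2) x = u (real (j - 2) * \<tau>) x - U (j - 2) x"
        using j elim(3) by (auto simp: e_def)
      have "\<tau> * D 1 (real j * \<tau>) x = \<tau> * (w' x + \<kappa> * u (real j * \<tau>) x + f (real j * \<tau>) x)"
        using elim(2) by simp
      then show ?case
        using elim(1) unfolding v_def e \<rho>_ge2[OF j(1)] by (simp add: algebra_simps)
    qed
    then have "L2_inner ?Q v (\<omega> k) = L2_inner ?Q (\<rho> j) (\<omega> k)"
      by (intro L2_inner_cong_AE v_L2 \<rho>_ge2_L2 j \<omega>)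
    moreover have "L2_inner ?Q v (\<omega> k) = (3/2 - \<kappa> * \<tau>) * L2_inner ?Q (e j) (\<omega> k)
        - 2 * L2_inner ?Q (e (j - 1)) (\<omega> k) + 1/2 * L2_inner ?Q (e (j - 2)) (\<omega> k)
        - \<tau> * L2_inner ?Q (\<lambda>x. w' x - w x) (\<omega> k)"
      unfolding v_def using L2 \<omega>
      by (simp only: L2_inner_diff L2_inner_add L2_inner_scale L2_diff L2_add L2_scale)
    ultimately show ?thesis
      using eigen_diff[OF _ w' w, of k] j by (simp add: z_def algebra_simps)
  qed

  have M': "0 \<le> M'" by (simp add: M'_def)
  have K: "0 \<le> K" using \<alpha> M' by (simp add: K_def)
  have truncation: "L2_norm ?Q (\<rho> j) \<le> K * real j powr (\<alpha> - 3)" if j: "1 \<le> j" "j \<le> N" for j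
  proof (rule L2_norm_le_dual)
    show "\<rho> j \<in> L2 ?Q"
      using \<rho>1_L2 \<rho>_ge2_L2[of j] j by (cases "j = 1") auto
    fix \<phi> assume \<phi>: "\<phi> \<in> L2 ?Q"
    \<comment> \<open>Pairing with a fixed \<open>\<phi>\<close> reduces the Taylor estimate to real
      functions; \<open>B\<close> carries the norm of \<open>\<phi>\<close>, as duality
      requires.\<close>
    define g where "g = (\<lambda>k t. L2_inner ?Q (D k t) \<phi>)"
    define B where "B = M' * L2_norm ?Q \<phi>"
    have B: "0 \<le> B" using M' by (simp add: B_def L2_norm_nonneg)
    have cont: "continuous_on {0..T} (g 0)"
      unfolding g_def D0 by (intro L2_continuous_on_inner u_cont \<phi>)
    have deriv: "(g k has_real_derivative g (Suc k) t) (at t within {0<..T})"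
      if "k < 3" "t \<in> {0<..T}" for k t
      unfolding g_def using that by (intro L2_has_derivative_on_inner D_deriv D_L2 \<phi>) auto
    have g_bound: "\<bar>g k t\<bar> \<le> B * t powr (\<alpha> - real k)" if k: "k \<in> {1, 2, 3}" and t: "t \<in> {0<..T}" for k t
    proof -
      have "\<bar>g k t\<bar> \<le> L2_norm ?Q (D k t) * L2_norm ?Q \<phi>"
        unfolding g_def using k t by (intro L2_Cauchy_Schwarz D_L2 \<phi>) auto
      also have "\<dots> \<le> (M * t powr (\<alpha> - real k)) * L2_norm ?Q \<phi>"
        by (intro mult_right_mono bound k t L2_norm_nonneg)
      also have "\<dots> \<le> (M' * t powr (\<alpha> - real k)) * L2_norm ?Q \<phi>"
        by (intro mult_right_mono L2_norm_nonneg) (auto simp: M'_def)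
      finally show ?thesis by (simp add: B_def mult_ac)
    qed
    show "\<bar>L2_inner ?Q (\<rho> j) \<phi>\<bar> \<le> K * real j powr (\<alpha> - 3) * L2_norm ?Q \<phi>"
    proof (cases "j = 1")
      case True
      have "L2_inner ?Q (\<rho> 1) \<phi> = g 0 \<tau> - g 0 0 - \<tau> * g 1 \<tau>"
        unfolding \<rho>1 g_def D0 using \<phi> u_L2 D_L2 \<tau>_time T
        by (simp add: L2_inner_diff L2_inner_scale L2_diff L2_scale)
      moreover have "\<bar>g 0 \<tau> - g 0 0 - \<tau> * g 1 \<tau>\<bar> \<le> (16 / \<alpha> + 9) * B * \<tau> powr \<alpha>"
        by (rule BDF2_truncation(1)[where g = g, OF \<alpha> \<tau>_pos B cont])
          (rule deriv g_bound, assumption+ | use \<tau>_time in simp)+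
      ultimately show ?thesis
        using True by (simp add: K_def B_def mult_ac)
    next
      case False
      then have j2: "2 \<le> j" using j by simp
      have L2: "u (real j * \<tau>) \<in> L2 ?Q" "u (real (j - 1) * \<tau>) \<in> L2 ?Q"
        "u (real (j - 2) * \<tau>) \<in> L2 ?Q" "D 1 (real j * \<tau>) \<in> L2 ?Q"
        using j by - (rule u_L2[OF time] D_L2[OF _ time_pos]; simp)+
      have "L2_inner ?Q (\<rho> j) \<phi> = 3/2 * g 0 (real j * \<tau>) - 2 * g 0 (real (j - 1) * \<tau>)
          + 1/2 * g 0 (real (j - 2) * \<tau>) - \<tau> * g 1 (real j * \<tau>)"
        unfolding \<rho>_ge2[OF j2] g_def D0 using L2 \<phi>
        by (simp only: L2_inner_diff L2_inner_add L2_inner_scale L2_diff L2_add L2_scale)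
      moreover have "\<bar>3/2 * g 0 (real j * \<tau>) - 2 * g 0 (real (j - 1) * \<tau>)
          + 1/2 * g 0 (real (j - 2) * \<tau>) - \<tau> * g 1 (real j * \<tau>)\<bar>
          \<le> (16 / \<alpha> + 9) * B * \<tau> powr \<alpha> * real j powr (\<alpha> - 3)"
        by (rule BDF2_truncation(2)[where g = g, OF \<alpha> \<tau>_pos B cont])
          (rule deriv g_bound, assumption+ | use time[OF j(2)] j2 in simp)+
      ultimately show ?thesis
        by (simp add: K_def B_def mult_ac)
    qed
  qed (use K in simp)

  define S where "S = (\<Sum>j=1..n. exp (- (3/4 * z0)) ^ (n - j) * (K * real j powr (\<alpha> - 3)))"
  have modes: "L2_set (\<lambda>k. L2_inner ?Q (e n) (\<omega> k)) {..<m} \<le> 8/3 * S" for m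
    unfolding S_def
  proof (rule BDF2_modes_stability[where r = "\<lambda>j k. L2_inner ?Q (\<rho> j) (\<omega> k)" and z = z and N = N])
    show "L2_inner ?Q (e 0) (\<omega> k) = 0" for k
      by (simp add: e_def L2_inner_zero)
    fix j assume j: "1 \<le> j" "j \<le> N"
    have "\<rho> j \<in> L2 ?Q"
      using \<rho>1_L2 \<rho>_ge2_L2[of j] j by (cases "j = 1") auto
    then have "L2_set (\<lambda>k. L2_inner ?Q (\<rho> j) (\<omega> k)) {..<m} \<le> L2_norm ?Q (\<rho> j)"
      by (intro L2_Bessel \<omega> orth)
    also have "\<dots> \<le> K * real j powr (\<alpha> - 3)"
      by (rule truncation[OF j])
    finally show "L2_set (\<lambda>k. L2_inner ?Q (\<rho> j) (\<omega> k)) {..<m} \<le> K * real j powr (\<alpha> - 3)" .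
  qed (fact z0 z_ge mode1 mode n)+
  \<comment> \<open>The bound \<open>modes\<close> is uniform in \<open>m\<close>, so completeness
    of the eigenbasis passes it on to the full norm.\<close>
  have "L2_norm ?Q (e n) \<le> 8/3 * S"
    by (rule L2_norm_le_Fourier[OF e_L2[OF n(2)] \<omega> orth _ modes])
      (use basis e_L2[OF n(2)] in \<open>simp add: dirichlet_eigenbasis_def\<close>)
  also have "S = K * (\<Sum>j=1..n. exp (- (3/4 * z0)) ^ (n - j) * real j powr (\<alpha> - 3))"
    by (simp add: S_def sum_distrib_left mult_ac)
  also have "8/3 * \<dots> \<le> 8/3 * (K * (2 * exp (- (real n * z0 / 2)) + 27 * real n powr (\<alpha> - 2)))"
    using \<alpha> z0 n by (intro mult_left_mono weighted_power_sum_le K) auto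
  also have "\<dots> = 8/3 * ((16 / \<alpha> + 9) * M') *
      (2 * (exp (- (real n * z0 / 2)) * \<tau> powr \<alpha>) + 27 * (real n powr (\<alpha> - 2) * \<tau> powr \<alpha>))"
    by (simp add: K_def algebra_simps)
  \<comment> \<open>Splitting off \<open>\<tau> powr (\<alpha> - 2)\<close> rescales the step number
    to the time and leaves the second-order factor.\<close>
  also have "real n powr (\<alpha> - 2) * \<tau> powr \<alpha> = (real n * \<tau>) powr (\<alpha> - 2) * \<tau>\<^sup>2"
  proof -
    have "\<tau> powr \<alpha> = \<tau> powr (\<alpha> - 2) * \<tau> powr 2"
      by (simp add: powr_add[symmetric])
    then show ?thesis using \<tau>_pos by (simp add: powr_mult)
  qed
  also have "- (real n * z0 / 2) = - (lam1 - \<kappa>) * (real n * \<tau>) / 2"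
    by (simp add: z0_def field_simps)
  also have "e n = (\<lambda>x. u (real n * \<tau>) x - U n x)"
    using n(1) by (simp add: e_def)
  finally show ?thesis
    unfolding M'_def .
qed

theorem theorem3p3:
  fixes \<alpha> M :: real
  assumes "0 < \<alpha>" "\<alpha> < 1"
  shows "\<exists>C>0. \<forall>(d::nat) \<Omega> (lam1::real) (\<kappa>::real) (T::real) (N::nat) (\<tau>::real) f u0 u D U.
    1 \<le> d \<longrightarrow> bounded_domain d \<Omega> \<longrightarrow>
    (\<exists>lam \<omega>. dirichlet_eigenbasis d \<Omega> lam \<omega>) \<longrightarrow>
    minimal_dirichlet_eigenvalue d \<Omega> lam1 \<longrightarrow> 0 < lam1 \<longrightarrow> \<kappa> < lam1 \<longrightarrow>
    0 < T \<longrightarrow> 2 \<le> N \<longrightarrow> \<tau> = T / real N \<longrightarrow>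
    parabolic_solution d \<Omega> T \<kappa> f u0 u D \<longrightarrow>
    (\<forall>k\<in>{1, 2, 3}. \<forall>t\<in>{0<..T}. L2_norm (leb_on d \<Omega>) (D k t) \<le> M * t powr (\<alpha> - real k)) \<longrightarrow>
    bdf2_scheme d \<Omega> \<kappa> f u0 \<tau> N U \<longrightarrow>
    \<tau> < 1 / (4 * (lam1 - \<kappa>)) \<longrightarrow>
    (\<forall>n. 1 \<le> n \<and> n \<le> N \<longrightarrow>
      (let t = (\<lambda>n. real n * \<tau>);
           e = (\<lambda>n x. u (t n) x - U n x)
       in L2_norm (leb_on d \<Omega>) (e n)
            \<le> exp (- (lam1 - \<kappa>) * t n / 2) * L2_norm (leb_on d \<Omega>) (e 0)
              + 2 * C * (C11 \<alpha> lam1 \<kappa> (t n) * exp (- (lam1 - \<kappa>) * t n / 2) * \<tau> powr \<alpha>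
                         + C12 \<alpha> lam1 \<kappa> (t n) * t n powr (\<alpha> - 2) * \<tau>\<^sup>2)))"
\<comment> \<open>The factors stem from stability (\<open>8/3\<close>), truncation and the
  derivative bound; \<open>55\<close> is half of the \<open>110\<close> of
  \<open>C11_C12_dominates\<close>, since the claim has \<open>2 * C\<close>.\<close>
proof (intro exI[of _ "8/3 * ((16 / \<alpha> + 9) * (\<bar>M\<bar> + 1)) * 55"] conjI allI impI)
  show "0 < 8/3 * ((16 / \<alpha> + 9) * (\<bar>M\<bar> + 1)) * 55"
    using assms by (intro mult_pos_pos add_pos_pos add_nonneg_pos) auto
next
  fix d \<Omega> f u0 u D U
  fix lam1 \<kappa> T \<tau> :: real and N n :: nat
  assume dom: "bounded_domain d \<Omega>" and "\<exists>lam \<omega>. dirichlet_eigenbasis d \<Omega> lam \<omega>"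
    and minimal: "minimal_dirichlet_eigenvalue d \<Omega> lam1" and \<kappa>: "\<kappa> < lam1"
    and T: "0 < T" and N: "2 \<le> N" and \<tau>: "\<tau> = T / real N"
    and sol: "parabolic_solution d \<Omega> T \<kappa> f u0 u D"
    and bound: "\<forall>k\<in>{1, 2, 3}. \<forall>t\<in>{0<..T}. L2_norm (leb_on d \<Omega>) (D k t) \<le> M * t powr (\<alpha> - real k)"
    and scheme: "bdf2_scheme d \<Omega> \<kappa> f u0 \<tau> N U"
    and small: "\<tau> < 1 / (4 * (lam1 - \<kappa>))" and n: "1 \<le> n \<and> n \<le> N"
  then obtain lam \<omega> where basis: "dirichlet_eigenbasis d \<Omega> lam \<omega>" by blast
  define t where "t = real n * \<tau>"
  define R where "R = C11 \<alpha> lam1 \<kappa> t * exp (- (lam1 - \<kappa>) * t / 2) * \<tau> powr \<alpha>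
      + C12 \<alpha> lam1 \<kappa> t * t powr (\<alpha> - 2) * \<tau>\<^sup>2"
  define c where "c = 8/3 * ((16 / \<alpha> + 9) * (\<bar>M\<bar> + 1))"
  have c: "0 \<le> c" using assms by (simp add: c_def)
  have \<tau>_pos: "0 < \<tau>" using T N \<tau> by simp
  have \<tau>_le: "\<tau> \<le> t"
    using mult_right_mono[of 1 "real n" \<tau>] n \<tau>_pos by (simp add: t_def)
  have "L2_norm (leb_on d \<Omega>) (\<lambda>x. u t x - U n x)
      \<le> c * (2 * (exp (- (lam1 - \<kappa>) * t / 2) * \<tau> powr \<alpha>) + 27 * (t powr (\<alpha> - 2) * \<tau>\<^sup>2))"
    unfolding t_def c_def
    by (rule BDF2_error_bound[OF assms dom basis minimal \<kappa> T N \<tau> sol _ scheme small])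
      (use bound n in auto)
  also have "\<dots> \<le> c * (110 * R)"
    unfolding R_def by (intro mult_left_mono C11_C12_dominates assms \<kappa> \<tau>_pos \<tau>_le c)
  also have "\<dots> = 2 * (c * 55) * R" by simp
  \<comment> \<open>The error is already controlled by the truncation terms; the initial term is
    nonnegative and merely added.\<close>
  also have "\<dots> \<le> exp (- (lam1 - \<kappa>) * t / 2) * L2_norm (leb_on d \<Omega>) (\<lambda>x. u (real 0 * \<tau>) x - U 0 x)
      + 2 * (c * 55) * R"
    by (simp add: L2_norm_nonneg)
  finally show "let t = (\<lambda>n. real n * \<tau>);
           e = (\<lambda>n x. u (t n) x - U n x)
       in L2_norm (leb_on d \<Omega>) (e n)
            \<le> exp (- (lam1 - \<kappa>) * t n / 2) * L2_norm (leb_on d \<Omega>) (e 0)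
              + 2 * (8/3 * ((16 / \<alpha> + 9) * (\<bar>M\<bar> + 1)) * 55) *
                (C11 \<alpha> lam1 \<kappa> (t n) * exp (- (lam1 - \<kappa>) * t n / 2) * \<tau> powr \<alpha>
                 + C12 \<alpha> lam1 \<kappa> (t n) * t n powr (\<alpha> - 2) * \<tau>\<^sup>2)"
    unfolding Let_def t_def R_def c_def .
qed

end
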